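(* Let $d\ge2$. Then $(\mathcal P_2(\mathbb R^d),SW)$ is not a length space; that is, $SW\ne\ell_{SW}$ on $\mathcal P_2(\mathbb R^d)$.
   Context: $\mathcal P_2(\mathbb R^d)$ is the set of Borel probability measures on $\mathbb R^d$ with finite second moment, $W$ the quadratic Wasserstein distance, $\sigma$ the uniform probability measure on $\mathbb S^{d-1}$. For $\theta\in\mathbb S^{d-1}$, $\hat\mu^\theta$ is the pushforward of $\mu$ under $x\mapsto x\cdot\theta$, and $SW^2(\mu,\nu)=\int_{\mathbb S^{d-1}}W^2(\hat\mu^\theta,\hat\nu^\theta)\,d\sigma(\theta)$. Length metric: a curve $(\mu_t)_{t\in[0,1]}$ in $\mathcal P_2(\mathbb R^d)$ is absolutely continuous in $SW$ if there is $g\in L^1(0,1)$ with $SW(\mu_s,\mu_t)\le\int_s^tg$ for all $s\le t$; its metric derivative $|\mu'|_{SW}(t)=\lim_{s\to t}SW(\mu_s,\mu_t)/|s-t|$ exists a.e., and $\ell_{SW}(\mu,\nu)=\inf\int_0^1|\mu'|_{SW}(t)\,dt$ over all such curves with $\mu_0=\mu$, $\mu_1=\nu$. A metric space is a length space if its distance equals the induced length metric. *)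

theory Defs
  imports "HOL-Probability.Probability"
begin

section \<open>The sliced Wasserstein distance\<close>

definition P2 :: "'a::euclidean_space measure set" where
  "P2 = {\<mu>. prob_space \<mu> \<and> sets \<mu> = sets borel \<and> integrable \<mu> (\<lambda>x. (norm x)\<^sup>2)}"

definition couplings ::
    "'a::euclidean_space measure \<Rightarrow> 'a measure \<Rightarrow> ('a \<times> 'a) measure set" where
  "couplings \<mu> \<nu> =
    {\<pi>. sets \<pi> = sets borel \<and> distr \<pi> borel fst = \<mu> \<and> distr \<pi> borel snd = \<nu>}"

text \<open>
  For \<open>\<mu>, \<nu> \<in> P2\<close> the product measure is a coupling and every coupling has finite cost, so the
  real-valued infimum and the Bochner integral take their intended values.
\<close>

definition wasserstein :: "'a::euclidean_space measure \<Rightarrow> 'a measure \<Rightarrow> real" where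
  "wasserstein \<mu> \<nu> =
    sqrt (INF \<pi>\<in>couplings \<mu> \<nu>. \<integral>z. (dist (fst z) (snd z))\<^sup>2 \<partial>\<pi>)"

text \<open>
  The uniform probability measure on the unit sphere, as a Borel measure on the ambient space
  that is concentrated on \<open>sphere 0 1\<close>: the direction of a uniformly distributed point of the
  unit ball (the origin, where \<open>sgn 0 = 0\<close>, has measure zero).
\<close>

definition sphere_uniform :: "'a::euclidean_space measure" where
  "sphere_uniform = distr (uniform_measure lborel (ball 0 1)) borel (\<lambda>x. sgn x)"

definition proj_measure :: "'a::euclidean_space \<Rightarrow> 'a measure \<Rightarrow> real measure" where
  "proj_measure \<theta> \<mu> = distr \<mu> borel (\<lambda>x. x \<bullet> \<theta>)"

definition SW :: "'a::euclidean_space measure \<Rightarrow> 'a measure \<Rightarrow> real" where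
  "SW \<mu> \<nu> =
    sqrt (\<integral>\<theta>. (wasserstein (proj_measure \<theta> \<mu>) (proj_measure \<theta> \<nu>))\<^sup>2 \<partial>sphere_uniform)"

section \<open>The length metric induced by a metric\<close>

definition abs_cont_curve :: "'b set \<Rightarrow> ('b \<Rightarrow> 'b \<Rightarrow> real) \<Rightarrow> (real \<Rightarrow> 'b) \<Rightarrow> bool" where
  "abs_cont_curve X d c \<longleftrightarrow>
    (\<forall>t\<in>{0..1}. c t \<in> X) \<and>
    (\<exists>g :: real \<Rightarrow> real. set_integrable lborel {0<..<1} g \<and>
      (\<forall>s t. 0 \<le> s \<and> s \<le> t \<and> t \<le> 1 \<longrightarrow>
        d (c s) (c t) \<le> (LINT r:{s<..<t}|lborel. g r)))"

text \<open>
  Along an absolutely continuous curve the limit exists for almost every \<open>t\<close>; the unspecified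
  value of \<open>Lim\<close> at the remaining times does not affect the length.
\<close>

definition metric_deriv :: "('b \<Rightarrow> 'b \<Rightarrow> real) \<Rightarrow> (real \<Rightarrow> 'b) \<Rightarrow> real \<Rightarrow> real" where
  "metric_deriv d c t = Lim (at t within {0..1}) (\<lambda>s. d (c s) (c t) / \<bar>s - t\<bar>)"

text \<open>The value is \<open>\<infinity>\<close> if no absolutely continuous curve joins \<open>x\<close> and \<open>y\<close>.\<close>

definition length_metric :: "'b set \<Rightarrow> ('b \<Rightarrow> 'b \<Rightarrow> real) \<Rightarrow> 'b \<Rightarrow> 'b \<Rightarrow> ennreal" where
  "length_metric X d x y =
    (INF c\<in>{c. abs_cont_curve X d c \<and> c 0 = x \<and> c 1 = y}.
      \<integral>\<^sup>+ t\<in>{0..1}. ennreal (metric_deriv d c t) \<partial>lborel)"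

text \<open>
  The metric axioms for \<open>d\<close> on \<open>X\<close> are deliberately not part of this predicate: its negation
  then says exactly that \<open>d\<close> differs from the induced length metric somewhere on \<open>X\<close>.
\<close>

definition length_space :: "'b set \<Rightarrow> ('b \<Rightarrow> 'b \<Rightarrow> real) \<Rightarrow> bool" where
  "length_space X d \<longleftrightarrow> (\<forall>x\<in>X. \<forall>y\<in>X. ennreal (d x y) = length_metric X d x y)"

end

theory Submission
  imports Defs
begin

text \<open>
  Write \<open>N\<^sub>\<mu>(\<theta>)\<close> for the \<open>L\<^sup>2\<close>-norm of \<open>x \<bullet> \<theta>\<close> under \<open>\<mu>\<close>, the distance of the projection of
  \<open>\<mu>\<close> from the Dirac mass at 0. The map \<open>\<mu> \<mapsto> N\<^sub>\<mu>\<close> into \<open>L\<^sup>2\<close> of the sphere is 1-Lipschitz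
  for \<open>SW\<close>, and it preserves the distance of the uniform measures \<open>\<mu>\<close>, \<open>\<nu>\<close> on \<open>{a, -a}\<close> and
  \<open>{b, -b}\<close> for orthonormal \<open>a\<close>, \<open>b\<close>. If \<open>SW\<close> were a length metric, then \<open>\<mu>\<close> and \<open>\<nu>\<close> would have
  approximate midpoints \<open>m\<close>, and the parallelogram identity would make \<open>N\<^sub>m\<close> arbitrarily close to
  \<open>(\<bar>a \<bullet> \<theta>\<bar> + \<bar>b \<bullet> \<theta>\<bar>) / 2\<close>. This is impossible, since \<open>N\<^sub>m\<^sup>2\<close> is a quadratic form.

  The approximate midpoints lie on curves of almost minimal length. Bounding that length below needs
  the almost everywhere existence of the metric derivative: it is the supremum of the derivatives of
  \<open>t \<mapsto> SW(\<mu>\<^sub>q, \<mu>\<^sub>t)\<close> over rational \<open>q\<close>. The triangle inequality for \<open>SW\<close> comes from the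
  optimality of the quantile coupling on the line.
\<close>

section \<open>Square integrable functions\<close>

lemma L2_mult_integrable:
  fixes f g :: "'a \<Rightarrow> real"
  assumes [measurable]: "f \<in> borel_measurable M" "g \<in> borel_measurable M"
    and "integrable M (\<lambda>x. (f x)\<^sup>2)" "integrable M (\<lambda>x. (g x)\<^sup>2)"
  shows "integrable M (\<lambda>x. f x * g x)"
proof (rule Bochner_Integration.integrable_bound)
  show "integrable M (\<lambda>x. (f x)\<^sup>2 + (g x)\<^sup>2)" using assms by simp
  have "\<bar>a * b\<bar> \<le> a\<^sup>2 + b\<^sup>2" for a b :: real
  proof -
    have "2 * \<bar>a\<bar> * \<bar>b\<bar> \<le> a\<^sup>2 + b\<^sup>2" using sum_squares_bound[of "\<bar>a\<bar>" "\<bar>b\<bar>"] by simp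
    moreover have "0 \<le> \<bar>a\<bar> * \<bar>b\<bar>" by simp
    ultimately show ?thesis unfolding abs_mult by linarith
  qed
  then show "AE x in M. norm (f x * g x) \<le> norm ((f x)\<^sup>2 + (g x)\<^sup>2)"
    by (intro AE_I2) (simp add: abs_of_nonneg)
qed simp

text \<open>The function sending \<open>t\<close> to the integral of
  \<open>(t * f x - g x)\<^sup>2\<close> is a nonnegative polynomial of degree at most two, so its
  discriminant cannot be positive.\<close>

lemma L2_Cauchy_Schwarz:
  fixes f g :: "'a \<Rightarrow> real"
  assumes [measurable]: "f \<in> borel_measurable M" "g \<in> borel_measurable M"
    and f: "integrable M (\<lambda>x. (f x)\<^sup>2)" and g: "integrable M (\<lambda>x. (g x)\<^sup>2)"
  shows "(\<integral>x. f x * g x \<partial>M) \<le> sqrt (\<integral>x. (f x)\<^sup>2 \<partial>M) * sqrt (\<integral>x. (g x)\<^sup>2 \<partial>M)"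
proof -
  let ?A = "\<integral>x. (f x)\<^sup>2 \<partial>M" and ?B = "\<integral>x. (g x)\<^sup>2 \<partial>M" and ?C = "\<integral>x. f x * g x \<partial>M"
  note fg = L2_mult_integrable[OF assms]
  have quad: "0 \<le> t\<^sup>2 * ?A - 2 * t * ?C + ?B" for t
  proof -
    have "0 \<le> (\<integral>x. (t * f x - g x)\<^sup>2 \<partial>M)" by simp
    also have "\<dots> = (\<integral>x. t\<^sup>2 * (f x)\<^sup>2 - 2 * t * (f x * g x) + (g x)\<^sup>2 \<partial>M)"
      by (intro Bochner_Integration.integral_cong) (auto simp: power2_eq_square algebra_simps)
    also have "\<dots> = t\<^sup>2 * ?A - 2 * t * ?C + ?B" using f g fg by simp
    finally show ?thesis .
  qed
  have A0: "0 \<le> ?A" by simp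
  have "?C\<^sup>2 \<le> ?A * ?B"
  proof (cases "?A = 0")
    case True
    \<comment> \<open>The polynomial is now affine in \<open>t\<close>; if \<open>?C\<close> were
      nonzero, the chosen \<open>t\<close> would give it the value \<open>-1\<close>.\<close>
    have "?C = 0"
      using quad[of "(?B + 1) / (2 * ?C)"] True by (cases "?C = 0") auto
    then show ?thesis using True by simp
  next
    case False
    then have pos: "0 < ?A" using A0 by linarith
    \<comment> \<open>The polynomial attains its minimum at \<open>t = ?C / ?A\<close>.\<close>
    have "0 \<le> ?A * ((?C / ?A)\<^sup>2 * ?A - 2 * (?C / ?A) * ?C + ?B)"
      using quad[of "?C / ?A"] pos by (intro mult_nonneg_nonneg) (simp_all only: less_imp_le)
    also have "\<dots> = ?A * ?B - ?C\<^sup>2" using False by (simp add: power2_eq_square algebra_simps)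
    finally show ?thesis by simp
  qed
  then have "?C \<le> sqrt (?A * ?B)" by (rule real_le_rsqrt)
  then show ?thesis by (simp add: real_sqrt_mult)
qed

lemma L2_add_integrable:
  fixes f g :: "'a \<Rightarrow> real"
  assumes [measurable]: "f \<in> borel_measurable M" "g \<in> borel_measurable M"
    and f: "integrable M (\<lambda>x. (f x)\<^sup>2)" and g: "integrable M (\<lambda>x. (g x)\<^sup>2)"
  shows "integrable M (\<lambda>x. (f x + g x)\<^sup>2)"
  using f g L2_mult_integrable[OF assms] by (simp add: power2_sum mult.assoc)

lemma L2_diff_integrable:
  fixes f g :: "'a \<Rightarrow> real"
  assumes [measurable]: "f \<in> borel_measurable M" "g \<in> borel_measurable M"
    and f: "integrable M (\<lambda>x. (f x)\<^sup>2)" and g: "integrable M (\<lambda>x. (g x)\<^sup>2)"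
  shows "integrable M (\<lambda>x. (f x - g x)\<^sup>2)"
  using L2_add_integrable[of f M "\<lambda>x. - g x"] f g by simp

lemma L2_triangle:
  fixes f g :: "'a \<Rightarrow> real"
  assumes [measurable]: "f \<in> borel_measurable M" "g \<in> borel_measurable M"
    and f: "integrable M (\<lambda>x. (f x)\<^sup>2)" and g: "integrable M (\<lambda>x. (g x)\<^sup>2)"
  shows "sqrt (\<integral>x. (f x + g x)\<^sup>2 \<partial>M) \<le> sqrt (\<integral>x. (f x)\<^sup>2 \<partial>M) + sqrt (\<integral>x. (g x)\<^sup>2 \<partial>M)"
proof (rule real_le_lsqrt)
  have "(\<integral>x. (f x + g x)\<^sup>2 \<partial>M)
      = (\<integral>x. (f x)\<^sup>2 \<partial>M) + (\<integral>x. (g x)\<^sup>2 \<partial>M) + 2 * (\<integral>x. f x * g x \<partial>M)"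
    using f g L2_mult_integrable[OF assms] by (simp add: power2_sum mult.assoc)
  also have "\<dots> \<le> (sqrt (\<integral>x. (f x)\<^sup>2 \<partial>M) + sqrt (\<integral>x. (g x)\<^sup>2 \<partial>M))\<^sup>2"
    using L2_Cauchy_Schwarz[OF assms] by (simp add: power2_sum mult.assoc)
  finally show "(\<integral>x. (f x + g x)\<^sup>2 \<partial>M)
    \<le> (sqrt (\<integral>x. (f x)\<^sup>2 \<partial>M) + sqrt (\<integral>x. (g x)\<^sup>2 \<partial>M))\<^sup>2" .
qed (auto intro!: add_nonneg_nonneg)

lemma L2_reverse_triangle:
  fixes f g :: "'a \<Rightarrow> real"
  assumes [measurable]: "f \<in> borel_measurable M" "g \<in> borel_measurable M"
    and f: "integrable M (\<lambda>x. (f x)\<^sup>2)" and g: "integrable M (\<lambda>x. (g x)\<^sup>2)"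
  shows "\<bar>sqrt (\<integral>x. (f x)\<^sup>2 \<partial>M) - sqrt (\<integral>x. (g x)\<^sup>2 \<partial>M)\<bar> \<le> sqrt (\<integral>x. (f x - g x)\<^sup>2 \<partial>M)"
proof -
  have "sqrt (\<integral>x. (u x)\<^sup>2 \<partial>M) \<le> sqrt (\<integral>x. (u x - v x)\<^sup>2 \<partial>M) + sqrt (\<integral>x. (v x)\<^sup>2 \<partial>M)"
    if [measurable]: "u \<in> borel_measurable M" "v \<in> borel_measurable M"
      and "integrable M (\<lambda>x. (u x)\<^sup>2)" "integrable M (\<lambda>x. (v x)\<^sup>2)" for u v :: "'a \<Rightarrow> real"
    using L2_triangle[of "\<lambda>x. u x - v x" M v] L2_diff_integrable[of u M v] that by simp
  from this[of f g] this[of g f] show ?thesis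
    using assms by (simp add: power2_commute abs_le_iff)
qed

section \<open>Optimal couplings on the line\<close>

text \<open>The triangle of all \<open>(s, t)\<close> with \<open>y \<le> s \<le> t < x\<close> has area \<open>(x - y)\<^sup>2 / 2\<close>.\<close>

lemma pos_part_square_eq_nn_integral:
  fixes x y :: real
  shows "ennreal ((max 0 (x - y))\<^sup>2) =
    (\<integral>\<^sup>+s. \<integral>\<^sup>+t. 2 * (if s \<le> t \<and> y \<le> s \<and> t < x then 1 else 0) \<partial>lborel \<partial>lborel)"
proof -
  \<comment> \<open>For \<open>s\<close> in \<open>{y..x}\<close> the section in \<open>t\<close> is
    \<open>{s..<x}\<close>, of length \<open>x - s\<close>; for all other \<open>s\<close> it is
    empty.\<close>
  have inner: "(\<integral>\<^sup>+t. 2 * (if s \<le> t \<and> y \<le> s \<and> t < x then 1 else 0) \<partial>lborel)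
      = ennreal (2 * (x - s)) * indicator {y..x} s" for s
  proof -
    have "(\<integral>\<^sup>+t. 2 * (if s \<le> t \<and> y \<le> s \<and> t < x then 1 else 0) \<partial>lborel)
      = (\<integral>\<^sup>+t. 2 * indicator (if y \<le> s then {s..<x} else {}) t \<partial>lborel)"
      by (intro nn_integral_cong) (auto simp: indicator_def)
    also have "\<dots> = 2 * emeasure lborel (if y \<le> s then {s..<x} else {})"
      by (subst nn_integral_cmult_indicator) auto
    also have "\<dots> = ennreal (2 * (x - s)) * indicator {y..x} s"
      by (auto simp: indicator_def ennreal_mult'[symmetric] simp flip: ennreal_numeral)
    finally show ?thesis .
  qed
  show ?thesis
  proof (cases "y \<le> x")
    case True
    have "(\<integral>\<^sup>+s. ennreal (2 * (x - s)) * indicator {y..x} s \<partial>lborel)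
      = ennreal (- (x - x)\<^sup>2 - (- (x - y)\<^sup>2))"
      by (rule nn_integral_FTC_Icc[where F = "\<lambda>s. - (x - s)\<^sup>2"])
        (use True in \<open>auto intro!: derivative_eq_intros\<close>)
    then show ?thesis using True by (simp add: inner)
  next
    case False
    then show ?thesis by (simp add: inner)
  qed
qed

text \<open>Integrate the triangle representation over \<open>M\<close> and exchange the integrals
  twice: what remains is the measure of those \<open>z\<close> whose triangle contains
  \<open>(s, t)\<close>. The joint law of \<open>X\<close> and \<open>Y\<close> enters only through
  these measures.\<close>

lemma nn_integral_pos_part_square:
  fixes X Y :: "'a \<Rightarrow> real"
  assumes "sigma_finite_measure M" and [measurable]: "X \<in> borel_measurable M" "Y \<in> borel_measurable M"
  shows "(\<integral>\<^sup>+z. ennreal ((max 0 (X z - Y z))\<^sup>2) \<partial>M) =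
    (\<integral>\<^sup>+s. \<integral>\<^sup>+t. (if s \<le> t then 2 * emeasure M {z \<in> space M. Y z \<le> s \<and> t < X z} else 0) \<partial>lborel \<partial>lborel)"
proof -
  interpret M: sigma_finite_measure M by fact
  interpret MM: pair_sigma_finite M "lborel :: real measure" ..
  have "(\<integral>\<^sup>+z. ennreal ((max 0 (X z - Y z))\<^sup>2) \<partial>M)
     = (\<integral>\<^sup>+z. \<integral>\<^sup>+s. \<integral>\<^sup>+t. 2 * (if s \<le> t \<and> Y z \<le> s \<and> t < X z then 1 else 0) \<partial>lborel \<partial>lborel \<partial>M)"
    by (simp only: pos_part_square_eq_nn_integral)
  also have "\<dots> = (\<integral>\<^sup>+s. \<integral>\<^sup>+z. \<integral>\<^sup>+t. 2 * (if s \<le> t \<and> Y z \<le> s \<and> t < X z then 1 else 0) \<partial>lborel \<partial>M \<partial>lborel)"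
    by (rule MM.Fubini'[symmetric]) simp
  also have "\<dots> = (\<integral>\<^sup>+s. \<integral>\<^sup>+t. \<integral>\<^sup>+z. 2 * (if s \<le> t \<and> Y z \<le> s \<and> t < X z then 1 else 0) \<partial>M \<partial>lborel \<partial>lborel)"
    by (intro nn_integral_cong MM.Fubini'[symmetric]) simp
  also have "\<dots> = (\<integral>\<^sup>+s. \<integral>\<^sup>+t. (if s \<le> t then 2 * emeasure M {z \<in> space M. Y z \<le> s \<and> t < X z} else 0) \<partial>lborel \<partial>lborel)"
  proof (intro nn_integral_cong)
    fix s t :: real
    have "(\<integral>\<^sup>+z. 2 * (if s \<le> t \<and> Y z \<le> s \<and> t < X z then 1 else 0) \<partial>M)
      = (\<integral>\<^sup>+z. 2 * indicator (if s \<le> t then {z \<in> space M. Y z \<le> s \<and> t < X z} else {}) z \<partial>M)"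
      by (intro nn_integral_cong) (auto simp: indicator_def)
    also have "\<dots> = 2 * emeasure M (if s \<le> t then {z \<in> space M. Y z \<le> s \<and> t < X z} else {})"
      by (subst nn_integral_cmult_indicator) auto
    finally show "(\<integral>\<^sup>+z. 2 * (if s \<le> t \<and> Y z \<le> s \<and> t < X z then 1 else 0) \<partial>M)
      = (if s \<le> t then 2 * emeasure M {z \<in> space M. Y z \<le> s \<and> t < X z} else 0)" by simp
  qed
  finally show ?thesis .
qed

section \<open>Quantile functions on the unit interval\<close>

abbreviation unit_interval :: "real measure" where
  "unit_interval \<equiv> restrict_space lborel {0<..<1}"

text \<open>This is the generalized inverse \<open>I\<close> from the locale
  \<open>cdf_distribution\<close>, whose properties it inherits. Its values are used for
  \<open>0 < u < 1\<close>, where the set is nonempty and bounded below.\<close>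

definition quantile :: "real measure \<Rightarrow> real \<Rightarrow> real" where
  "quantile \<mu> u = Inf {x. u \<le> cdf \<mu> x}"

lemma quantile_measurable [measurable]:
  assumes "real_distribution \<mu>"
  shows "quantile \<mu> \<in> borel_measurable unit_interval"
proof -
  interpret cdf_distribution \<mu> using assms by (simp add: cdf_distribution_def)
  have "quantile \<mu> = I" by (auto simp: quantile_def)
  then show ?thesis using measurable_CI
    by (simp cong: measurable_cong_sets add: sets_restrict_space)
qed

lemma distr_quantile:
  assumes "real_distribution \<mu>"
  shows "distr unit_interval borel (quantile \<mu>) = \<mu>"
proof -
  interpret cdf_distribution \<mu> using assms by (simp add: cdf_distribution_def)
  have "quantile \<mu> = I" by (auto simp: quantile_def)
  then show ?thesis using distr_I_eq_M by simp
qed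

text \<open>This Galois connection turns events about quantiles into intervals of parameters
  \<open>u\<close>, whose Lebesgue measure is a difference of distribution functions.\<close>

lemma quantile_le_iff:
  assumes "real_distribution \<mu>" "0 < u" "u < 1"
  shows "quantile \<mu> u \<le> x \<longleftrightarrow> u \<le> cdf \<mu> x"
proof -
  interpret cdf_distribution \<mu> using assms by (simp add: cdf_distribution_def)
  show ?thesis using pseudoinverse[of u x] assms by (simp add: quantile_def)
qed

lemma prob_space_unit_interval: "prob_space unit_interval"
  by (auto simp add: emeasure_restrict_space space_restrict_space intro!: prob_spaceI)

section \<open>Elementary facts on \<open>P2\<close> and couplings\<close>

lemma P2_real_distribution: "\<mu> \<in> P2 \<Longrightarrow> real_distribution \<mu>"
  by (auto simp: P2_def real_distribution_def real_distribution_axioms_def)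

lemma P2_prob_space: "\<mu> \<in> P2 \<Longrightarrow> prob_space \<mu>"
  and P2_sets: "\<mu> \<in> P2 \<Longrightarrow> sets \<mu> = sets borel"
  and P2_integrable: "\<mu> \<in> P2 \<Longrightarrow> integrable \<mu> (\<lambda>x. (norm x)\<^sup>2)"
  by (auto simp: P2_def)

lemma couplings_sets: "\<pi> \<in> couplings \<mu> \<nu> \<Longrightarrow> sets \<pi> = sets borel"
  and couplings_fst: "\<pi> \<in> couplings \<mu> \<nu> \<Longrightarrow> distr \<pi> borel fst = \<mu>"
  and couplings_snd: "\<pi> \<in> couplings \<mu> \<nu> \<Longrightarrow> distr \<pi> borel snd = \<nu>"
  by (auto simp: couplings_def)

lemma couplings_measurable:
  assumes "\<pi> \<in> couplings \<mu> \<nu>"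
  shows "fst \<in> borel_measurable \<pi>" "snd \<in> borel_measurable \<pi>"
  unfolding measurable_cong_sets[OF couplings_sets[OF assms] refl]
  by (auto intro!: borel_measurable_continuous_onI continuous_intros)

lemma couplings_prob_space:
  assumes "\<pi> \<in> couplings \<mu> \<nu>" "prob_space \<mu>"
  shows "prob_space \<pi>"
  using prob_space_distrD[OF couplings_measurable(1)[OF assms(1)]] couplings_fst[OF assms(1)] assms(2)
  by simp

text \<open>
  By Tonelli the cost is an integral of the probabilities of \<open>Y \<le> s \<and> t < X\<close> and
  \<open>X \<le> s \<and> t < Y\<close>, and the quantile coupling minimises each of them simultaneously.
\<close>

lemma quantile_coupling_optimal:
  assumes \<mu>: "real_distribution \<mu>" and \<nu>: "real_distribution \<nu>" and \<pi>: "\<pi> \<in> couplings \<mu> \<nu>"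
  shows "(\<integral>\<^sup>+u. ennreal ((quantile \<mu> u - quantile \<nu> u)\<^sup>2) \<partial>unit_interval)
    \<le> (\<integral>\<^sup>+z. ennreal ((fst z - snd z)\<^sup>2) \<partial>\<pi>)"
proof -
  interpret \<mu>: real_distribution \<mu> by fact
  interpret \<nu>: real_distribution \<nu> by fact
  interpret \<pi>: prob_space \<pi> using couplings_prob_space[OF \<pi>] \<mu>.prob_space_axioms .
  interpret U: prob_space unit_interval by (rule prob_space_unit_interval)
  note [measurable] = couplings_measurable[OF \<pi>] quantile_measurable[OF \<mu>] quantile_measurable[OF \<nu>]
  \<comment> \<open>At most one of the two positive parts is nonzero. The two terms are treated by
    the same bound \<open>half\<close>, with the roles of the measures exchanged.\<close>
  have sq: "ennreal ((x - y)\<^sup>2) = ennreal ((max 0 (x - y))\<^sup>2) + ennreal ((max 0 (y - x))\<^sup>2)" for x y :: real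
    by (cases "x \<le> y") (auto simp: max_def power2_commute)
  have half: "(\<integral>\<^sup>+u. ennreal ((max 0 (quantile \<alpha> u - quantile \<beta> u))\<^sup>2) \<partial>unit_interval)
      \<le> (\<integral>\<^sup>+z. ennreal ((max 0 (X z - Y z))\<^sup>2) \<partial>\<pi>)"
    if \<alpha>: "real_distribution \<alpha>" and \<beta>: "real_distribution \<beta>"
      and [measurable]: "X \<in> borel_measurable \<pi>" "Y \<in> borel_measurable \<pi>"
      and X: "distr \<pi> borel X = \<alpha>" and Y: "distr \<pi> borel Y = \<beta>"
    for \<alpha> \<beta> :: "real measure" and X Y :: "real \<times> real \<Rightarrow> real"
  proof -
    interpret \<alpha>: real_distribution \<alpha> by fact
    interpret \<beta>: real_distribution \<beta> by fact
    note [measurable] = quantile_measurable[OF \<alpha>] quantile_measurable[OF \<beta>]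
    \<comment> \<open>The event on the left forces \<open>u\<close> into
      \<open>{cdf \<alpha> t<..cdf \<beta> s}\<close>. The positive part of
      \<open>cdf \<beta> s - cdf \<alpha> t\<close> bounds the probability on the right from below,
      whatever the joint law is.\<close>
    have le: "emeasure unit_interval {u \<in> space unit_interval. quantile \<beta> u \<le> s \<and> t < quantile \<alpha> u}
      \<le> emeasure \<pi> {z \<in> space \<pi>. Y z \<le> s \<and> t < X z}" for s t
    proof -
      have "emeasure unit_interval {u \<in> space unit_interval. quantile \<beta> u \<le> s \<and> t < quantile \<alpha> u}
        \<le> emeasure lborel {cdf \<alpha> t<..cdf \<beta> s}"
        by (subst emeasure_restrict_space)
          (auto simp: space_restrict_space quantile_le_iff[OF \<alpha>] quantile_le_iff[OF \<beta>]
            not_le[symmetric] intro!: emeasure_mono)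
      also have "\<dots> \<le> ennreal (cdf \<beta> s - cdf \<alpha> t)"
        by (cases "cdf \<alpha> t \<le> cdf \<beta> s") auto
      also have "\<dots> \<le> ennreal (measure \<pi> {z \<in> space \<pi>. Y z \<le> s \<and> t < X z})"
      proof (rule ennreal_leI)
        have "cdf \<beta> s = measure \<pi> {z \<in> space \<pi>. Y z \<le> s}"
          unfolding cdf_def Y[symmetric] by (subst measure_distr) (auto intro!: arg_cong[where f="measure \<pi>"])
        moreover have "cdf \<alpha> t = measure \<pi> {z \<in> space \<pi>. X z \<le> t}"
          unfolding cdf_def X[symmetric] by (subst measure_distr) (auto intro!: arg_cong[where f="measure \<pi>"])
        \<comment> \<open>Where \<open>Y \<le> s\<close> holds, either \<open>X \<le> t\<close> or
          \<open>t < X\<close>.\<close>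
        moreover have "measure \<pi> {z \<in> space \<pi>. Y z \<le> s}
          \<le> measure \<pi> ({z \<in> space \<pi>. X z \<le> t} \<union> {z \<in> space \<pi>. Y z \<le> s \<and> t < X z})"
          by (intro \<pi>.finite_measure_mono) auto
        moreover have "\<dots> \<le> measure \<pi> {z \<in> space \<pi>. X z \<le> t} + measure \<pi> {z \<in> space \<pi>. Y z \<le> s \<and> t < X z}"
          by (intro measure_Un_le) auto
        ultimately show "cdf \<beta> s - cdf \<alpha> t \<le> measure \<pi> {z \<in> space \<pi>. Y z \<le> s \<and> t < X z}"
          by linarith
      qed
      finally show ?thesis by (simp add: \<pi>.emeasure_eq_measure)
    qed
    show ?thesis
      by (subst (1 2) nn_integral_pos_part_square)
        (auto intro!: nn_integral_mono mult_left_mono le[simplified]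
          simp: U.sigma_finite_measure_axioms \<pi>.sigma_finite_measure_axioms)
  qed
  show ?thesis
    unfolding sq
    by (subst (1 2) nn_integral_add)
      (auto intro!: add_mono half \<mu> \<nu> couplings_fst[OF \<pi>] couplings_snd[OF \<pi>])
qed

section \<open>The Wasserstein distance on the line\<close>

lemma bdd_below_coupling_cost:
  "bdd_below ((\<lambda>\<pi>. \<integral>z. (dist (fst z) (snd z))\<^sup>2 \<partial>\<pi>) ` A)"
  by (rule bdd_belowI2[of _ 0]) simp

lemma coupling_distr:
  fixes X Y :: "'b \<Rightarrow> 'a::euclidean_space"
  assumes [measurable]: "X \<in> borel_measurable M" "Y \<in> borel_measurable M"
  shows "distr M borel (\<lambda>u. (X u, Y u)) \<in> couplings (distr M borel X) (distr M borel Y)"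
proof -
  have [measurable]: "(\<lambda>u. (X u, Y u)) \<in> borel_measurable M"
    unfolding borel_prod[symmetric] by measurable
  show ?thesis
    unfolding couplings_def
    by (simp add: distr_distr borel_measurable_continuous_onI continuous_on_fst continuous_on_snd
        continuous_on_id comp_def)
qed

text \<open>The joint law of \<open>X\<close> and \<open>Y\<close> is an admissible coupling. The
  explicit upper bounds for \<open>wasserstein\<close> below are obtained by realising both measures
  on one space.\<close>

lemma wasserstein_le:
  fixes X Y :: "'b \<Rightarrow> 'a::euclidean_space"
  assumes [measurable]: "X \<in> borel_measurable M" "Y \<in> borel_measurable M"
  shows "wasserstein (distr M borel X) (distr M borel Y) \<le> sqrt (\<integral>u. (dist (X u) (Y u))\<^sup>2 \<partial>M)"
proof -
  have [measurable]: "(\<lambda>u. (X u, Y u)) \<in> borel_measurable M"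
    unfolding borel_prod[symmetric] by measurable
  have "(INF \<pi>\<in>couplings (distr M borel X) (distr M borel Y). \<integral>z. (dist (fst z) (snd z))\<^sup>2 \<partial>\<pi>)
    \<le> (\<integral>z. (dist (fst z) (snd z))\<^sup>2 \<partial>distr M borel (\<lambda>u. (X u, Y u)))"
    by (intro cINF_lower bdd_below_coupling_cost coupling_distr) auto
  also have "\<dots> = (\<integral>u. (dist (X u) (Y u))\<^sup>2 \<partial>M)"
    by (subst integral_distr)
      (auto intro!: borel_measurable_continuous_onI continuous_intros)
  finally show ?thesis unfolding wasserstein_def by (rule real_sqrt_le_mono)
qed

lemma P2_real_square_integrable: "\<mu> \<in> P2 \<Longrightarrow> integrable \<mu> (\<lambda>x::real. x\<^sup>2)"
  using P2_integrable[of \<mu>] by simp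

lemma quantile_square_integrable:
  assumes "\<mu> \<in> P2"
  shows "integrable unit_interval (\<lambda>u. (quantile \<mu> u)\<^sup>2)"
proof (rule integrable_distr[where f = "\<lambda>x. x\<^sup>2"])
  show "quantile \<mu> \<in> measurable unit_interval borel"
    using quantile_measurable[OF P2_real_distribution[OF assms]] .
  show "integrable (distr unit_interval borel (quantile \<mu>)) (\<lambda>x. x\<^sup>2)"
    using P2_real_square_integrable[OF assms]
    by (simp add: distr_quantile[OF P2_real_distribution[OF assms]])
qed

text \<open>The quantile coupling is admissible and optimal. Thus \<open>quantile\<close> embeds the
  measures on the line isometrically into \<open>L\<^sup>2\<close> of the unit interval, and the
  metric properties of \<open>wasserstein\<close> follow from those of the norm.\<close>

lemma wasserstein_real_eq:
  assumes \<mu>: "\<mu> \<in> P2" and \<nu>: "\<nu> \<in> P2"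
  shows "wasserstein \<mu> \<nu> = sqrt (\<integral>u. (quantile \<mu> u - quantile \<nu> u)\<^sup>2 \<partial>unit_interval)"
proof (rule antisym)
  note D = P2_real_distribution[OF \<mu>] P2_real_distribution[OF \<nu>]
  note [measurable] = quantile_measurable[OF D(1)] quantile_measurable[OF D(2)]
  note dist = distr_quantile[OF D(1)] distr_quantile[OF D(2)]
  show "wasserstein \<mu> \<nu> \<le> sqrt (\<integral>u. (quantile \<mu> u - quantile \<nu> u)\<^sup>2 \<partial>unit_interval)"
    using wasserstein_le[of "quantile \<mu>" unit_interval "quantile \<nu>"]
    unfolding dist by (simp add: dist_real_def)
  have "(\<integral>u. (quantile \<mu> u - quantile \<nu> u)\<^sup>2 \<partial>unit_interval) \<le> (\<integral>z. (dist (fst z) (snd z))\<^sup>2 \<partial>\<pi>)"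
    if \<pi>: "\<pi> \<in> couplings \<mu> \<nu>" for \<pi>
  proof -
    note [measurable] = couplings_measurable[OF \<pi>]
    have i: "integrable \<pi> (\<lambda>z. (fst z)\<^sup>2)" "integrable \<pi> (\<lambda>z. (snd z)\<^sup>2)"
      using P2_real_square_integrable[OF \<mu>] P2_real_square_integrable[OF \<nu>]
      unfolding couplings_fst[OF \<pi>, symmetric] couplings_snd[OF \<pi>, symmetric]
      by (auto simp: integrable_distr_eq)
    have ip: "integrable \<pi> (\<lambda>z. (fst z - snd z)\<^sup>2)"
      by (rule L2_diff_integrable) (use i in auto)
    have iq: "integrable unit_interval (\<lambda>u. (quantile \<mu> u - quantile \<nu> u)\<^sup>2)"
      by (rule L2_diff_integrable) (use quantile_square_integrable \<mu> \<nu> in auto)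
    show ?thesis
      using quantile_coupling_optimal[OF D \<pi>]
      by (simp add: nn_integral_eq_integral[OF ip] nn_integral_eq_integral[OF iq] dist_real_def)
  qed
  \<comment> \<open>A lower bound for every cost passes to the real infimum only if the set of costs
    is nonempty.\<close>
  moreover have "couplings \<mu> \<nu> \<noteq> {}"
    using coupling_distr[of "quantile \<mu>" unit_interval "quantile \<nu>"] unfolding dist by auto
  ultimately show "sqrt (\<integral>u. (quantile \<mu> u - quantile \<nu> u)\<^sup>2 \<partial>unit_interval) \<le> wasserstein \<mu> \<nu>"
    unfolding wasserstein_def by (intro real_sqrt_le_mono cINF_greatest) auto
qed

lemma wasserstein_real_triangle:
  assumes "\<mu> \<in> P2" "\<nu> \<in> P2" "\<rho> \<in> P2"
  shows "wasserstein \<mu> \<rho> \<le> wasserstein \<mu> \<nu> + wasserstein \<nu> (\<rho> :: real measure)"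
proof -
  note [measurable] = assms[THEN P2_real_distribution, THEN quantile_measurable]
  note i = assms[THEN quantile_square_integrable]
  show ?thesis
    using L2_triangle[of "\<lambda>u. quantile \<mu> u - quantile \<nu> u" unit_interval
        "\<lambda>u. quantile \<nu> u - quantile \<rho> u"] i
    by (simp add: wasserstein_real_eq assms L2_diff_integrable)
qed

lemma wasserstein_real_commute:
  assumes "\<mu> \<in> P2" "\<nu> \<in> P2"
  shows "wasserstein \<mu> \<nu> = wasserstein \<nu> (\<mu> :: real measure)"
  using assms by (simp add: wasserstein_real_eq power2_commute)

lemma wasserstein_real_self:
  fixes \<mu> :: "real measure"
  assumes "\<mu> \<in> P2"
  shows "wasserstein \<mu> \<mu> = 0"
  using assms by (simp add: wasserstein_real_eq)

lemma wasserstein_real_nonneg: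
  assumes "\<mu> \<in> P2" "\<nu> \<in> P2"
  shows "0 \<le> wasserstein \<mu> (\<nu> :: real measure)"
  using assms by (simp add: wasserstein_real_eq)

lemma integral_quantile_square:
  assumes "\<mu> \<in> P2"
  shows "(\<integral>u. (quantile \<mu> u)\<^sup>2 \<partial>unit_interval) = (\<integral>x. x\<^sup>2 \<partial>\<mu>)"
proof -
  note [measurable] = quantile_measurable[OF P2_real_distribution[OF assms]]
  have "(\<integral>x. x\<^sup>2 \<partial>\<mu>) = (\<integral>x. x\<^sup>2 \<partial>distr unit_interval borel (quantile \<mu>))"
    by (simp add: distr_quantile[OF P2_real_distribution[OF assms]])
  also have "\<dots> = (\<integral>u. (quantile \<mu> u)\<^sup>2 \<partial>unit_interval)"
    by (rule integral_distr) auto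
  finally show ?thesis by simp
qed

text \<open>The roots of the second moments are the \<open>L\<^sup>2\<close> norms of the quantile
  functions, so the reverse triangle inequality applies.\<close>

lemma second_moment_diff_le_wasserstein:
  assumes "\<mu> \<in> P2" "\<nu> \<in> P2"
  shows "\<bar>sqrt (\<integral>x. x\<^sup>2 \<partial>\<mu>) - sqrt (\<integral>x. x\<^sup>2 \<partial>\<nu>)\<bar> \<le> wasserstein \<mu> \<nu>"
proof -
  note [measurable] = assms[THEN P2_real_distribution, THEN quantile_measurable]
  show ?thesis
    using L2_reverse_triangle[of "quantile \<mu>" unit_interval "quantile \<nu>"]
      assms[THEN quantile_square_integrable]
    by (simp add: wasserstein_real_eq assms integral_quantile_square)
qed

section \<open>The sliced Wasserstein distance as a pseudometric\<close>

lemma inner_measurable_P2: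
  assumes "sets \<mu> = sets borel"
  shows "(\<lambda>x. x \<bullet> \<theta>) \<in> borel_measurable \<mu>"
  unfolding measurable_cong_sets[OF assms refl]
  by (auto intro!: borel_measurable_continuous_onI continuous_intros)

lemma inner_square_integrable:
  assumes "\<mu> \<in> P2"
  shows "integrable \<mu> (\<lambda>x. (x \<bullet> \<theta>)\<^sup>2)"
proof (rule Bochner_Integration.integrable_bound)
  note [measurable] = inner_measurable_P2[OF P2_sets[OF assms]]
  show "integrable \<mu> (\<lambda>x. (norm \<theta>)\<^sup>2 * (norm x)\<^sup>2)" using P2_integrable[OF assms] by simp
  show "(\<lambda>x. (x \<bullet> \<theta>)\<^sup>2) \<in> borel_measurable \<mu>" by measurable
  have "(x \<bullet> \<theta>)\<^sup>2 \<le> (norm \<theta>)\<^sup>2 * (norm x)\<^sup>2" for x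
    using Cauchy_Schwarz_ineq2[of x \<theta>] by (simp add: power_mult_distrib[symmetric] abs_le_square_iff[symmetric] mult.commute)
  then show "AE x in \<mu>. norm ((x \<bullet> \<theta>)\<^sup>2) \<le> norm ((norm \<theta>)\<^sup>2 * (norm x)\<^sup>2)"
    by (intro AE_I2) (simp add: abs_mult)
qed

lemma proj_measure_P2:
  assumes "\<mu> \<in> P2"
  shows "proj_measure \<theta> \<mu> \<in> P2"
proof -
  note [measurable] = inner_measurable_P2[OF P2_sets[OF assms]]
  interpret prob_space \<mu> using assms by (rule P2_prob_space)
  show ?thesis
    using inner_square_integrable[OF assms]
    by (auto simp: P2_def proj_measure_def integrable_distr_eq intro!: prob_space_distr)
qed

text \<open>This is \<open>N\<^sub>\<mu>(\<theta>)\<close>. Admitting all vectors \<theta>, not only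
  unit vectors, makes it absolutely homogeneous and its square a quadratic form on the whole
  space.\<close>

definition directional_moment :: "'a::euclidean_space measure \<Rightarrow> 'a \<Rightarrow> real" where
  "directional_moment \<mu> \<theta> = sqrt (\<integral>x. (x \<bullet> \<theta>)\<^sup>2 \<partial>\<mu>)"

lemma directional_moment_proj:
  assumes "\<mu> \<in> P2"
  shows "directional_moment \<mu> \<theta> = sqrt (\<integral>x. x\<^sup>2 \<partial>proj_measure \<theta> \<mu>)"
proof -
  note [measurable] = inner_measurable_P2[OF P2_sets[OF assms]]
  show ?thesis
    unfolding directional_moment_def proj_measure_def by (subst integral_distr) auto
qed

lemma directional_moment_scaleR:
  "directional_moment \<mu> (c *\<^sub>R \<theta>) = \<bar>c\<bar> * directional_moment \<mu> \<theta>"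
  by (simp add: directional_moment_def power_mult_distrib real_sqrt_mult)

text \<open>Couple the two projections through the same point \<open>x\<close>; the cost is then the
  second moment of \<open>x \<bullet> (\<theta> - \<eta>)\<close>.\<close>

lemma wasserstein_proj_shift:
  assumes "\<mu> \<in> P2"
  shows "wasserstein (proj_measure \<theta> \<mu>) (proj_measure \<eta> \<mu>)
    \<le> sqrt (\<integral>x. (norm x)\<^sup>2 \<partial>\<mu>) * dist \<theta> \<eta>"
proof -
  note [measurable] = inner_measurable_P2[OF P2_sets[OF assms]]
  have "wasserstein (proj_measure \<theta> \<mu>) (proj_measure \<eta> \<mu>)
    \<le> sqrt (\<integral>x. (x \<bullet> (\<theta> - \<eta>))\<^sup>2 \<partial>\<mu>)"
    using wasserstein_le[of "\<lambda>x. x \<bullet> \<theta>" \<mu> "\<lambda>x. x \<bullet> \<eta>"]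
    by (simp add: proj_measure_def dist_real_def inner_diff_right)
  also have "\<dots> \<le> sqrt (\<integral>x. (norm x)\<^sup>2 * (norm (\<theta> - \<eta>))\<^sup>2 \<partial>\<mu>)"
  proof (intro real_sqrt_le_mono integral_mono inner_square_integrable assms)
    show "integrable \<mu> (\<lambda>x. (norm x)\<^sup>2 * (norm (\<theta> - \<eta>))\<^sup>2)" using P2_integrable[OF assms] by simp
    show "(x \<bullet> (\<theta> - \<eta>))\<^sup>2 \<le> (norm x)\<^sup>2 * (norm (\<theta> - \<eta>))\<^sup>2" for x
      using Cauchy_Schwarz_ineq2[of x "\<theta> - \<eta>"]
      by (simp add: power_mult_distrib[symmetric] abs_le_square_iff[symmetric])
  qed
  also have "\<dots> = sqrt (\<integral>x. (norm x)\<^sup>2 \<partial>\<mu>) * dist \<theta> \<eta>"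
    by (simp add: real_sqrt_mult dist_norm)
  finally show ?thesis .
qed

text \<open>Lipschitz dependence on the direction makes the integrand of \<open>SW\<close>
  measurable; comparison with the direction 0 bounds it on the unit ball.\<close>

lemma wasserstein_proj_lipschitz:
  assumes "\<mu> \<in> P2" "\<nu> \<in> P2"
  shows "wasserstein (proj_measure \<theta> \<mu>) (proj_measure \<theta> \<nu>) \<le>
    wasserstein (proj_measure \<eta> \<mu>) (proj_measure \<eta> \<nu>) +
    (sqrt (\<integral>x. (norm x)\<^sup>2 \<partial>\<mu>) + sqrt (\<integral>x. (norm x)\<^sup>2 \<partial>\<nu>)) * dist \<theta> \<eta>"
  using wasserstein_real_triangle[of "proj_measure \<theta> \<mu>" "proj_measure \<eta> \<mu>" "proj_measure \<theta> \<nu>"]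
    wasserstein_real_triangle[of "proj_measure \<eta> \<mu>" "proj_measure \<eta> \<nu>" "proj_measure \<theta> \<nu>"]
    wasserstein_proj_shift[OF assms(1), of \<theta> \<eta>] wasserstein_proj_shift[OF assms(2), of \<eta> \<theta>]
  by (simp add: assms proj_measure_P2 algebra_simps dist_commute)

lemma continuous_on_lipschitz_real:
  fixes f :: "'a::metric_space \<Rightarrow> real"
  assumes "0 \<le> L" "\<And>x y. f x \<le> f y + L * dist x y"
  shows "continuous_on UNIV f"
proof (rule lipschitz_on_continuous_on)
  show "L-lipschitz_on UNIV f"
  proof (intro lipschitz_onI assms(1))
    show "dist (f x) (f y) \<le> L * dist x y" for x y
      using assms(2)[of x y] assms(2)[of y x] by (simp add: dist_real_def dist_commute abs_le_iff)
  qed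
qed

lemma wasserstein_proj_measurable:
  assumes "\<mu> \<in> P2" "\<nu> \<in> P2"
  shows "(\<lambda>\<theta>. wasserstein (proj_measure \<theta> \<mu>) (proj_measure \<theta> \<nu>)) \<in> borel_measurable borel"
  by (intro borel_measurable_continuous_onI continuous_on_lipschitz_real[OF _ wasserstein_proj_lipschitz[OF assms]]) auto

lemma directional_moment_measurable:
  assumes "\<mu> \<in> P2"
  shows "directional_moment \<mu> \<in> borel_measurable borel"
proof (intro borel_measurable_continuous_onI continuous_on_lipschitz_real)
  fix x y
  show "directional_moment \<mu> x \<le> directional_moment \<mu> y + sqrt (\<integral>x. (norm x)\<^sup>2 \<partial>\<mu>) * dist x y"
    using second_moment_diff_le_wasserstein[of "proj_measure x \<mu>" "proj_measure y \<mu>"]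
      wasserstein_proj_shift[OF assms, of x y]
    by (simp add: assms proj_measure_P2 directional_moment_proj)
qed simp

section \<open>Integration against the uniform measure on the sphere\<close>

lemma prob_space_uniform_ball: "prob_space (uniform_measure lborel (ball (0::'a::euclidean_space) 1))"
proof (rule prob_space_uniform_measure)
  show "emeasure lborel (ball (0::'a) 1) \<noteq> \<infinity>"
    using emeasure_lborel_ball_finite[of "0::'a" 1] by simp
  then show "emeasure lborel (ball (0::'a) 1) \<noteq> 0"
    using content_ball_pos[of 1 "0::'a"] by (auto simp: measure_def)
qed

lemma sgn_borel_measurable [measurable]: "(sgn :: 'a::euclidean_space \<Rightarrow> 'a) \<in> borel_measurable borel"
  unfolding sgn_div_norm[abs_def] by measurable

lemma prob_space_sphere_uniform: "prob_space (sphere_uniform :: 'a::euclidean_space measure)"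
proof -
  interpret prob_space "uniform_measure lborel (ball (0::'a) 1)" by (rule prob_space_uniform_ball)
  show ?thesis unfolding sphere_uniform_def by (rule prob_space_distr) simp
qed

lemma sets_sphere_uniform [measurable_cong]: "sets sphere_uniform = sets borel"
  by (simp add: sphere_uniform_def)

text \<open>A vector \<open>sgn x\<close> has norm 1 or, for \<open>x = 0\<close>, norm 0. The
  inequality covers both cases and is all that bounded integrands require.\<close>

lemma AE_sphere_uniform_norm_le: "AE \<theta> in sphere_uniform. norm (\<theta>::'a::euclidean_space) \<le> 1"
  unfolding sphere_uniform_def by (subst AE_distr_iff) (auto simp: norm_sgn)

lemma sphere_uniform_square_integrable:
  fixes f :: "'a::euclidean_space \<Rightarrow> real"
  assumes [measurable]: "f \<in> borel_measurable borel"
    and f: "\<And>\<theta>. norm \<theta> \<le> 1 \<Longrightarrow> \<bar>f \<theta>\<bar> \<le> B"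
  shows "integrable sphere_uniform (\<lambda>\<theta>. (f \<theta>)\<^sup>2)"
proof -
  interpret prob_space "sphere_uniform :: 'a measure" by (rule prob_space_sphere_uniform)
  show ?thesis
  proof (rule integrable_const_bound)
    show "AE \<theta> in sphere_uniform. norm ((f \<theta>)\<^sup>2) \<le> B\<^sup>2"
      using AE_sphere_uniform_norm_le
      by eventually_elim (use f in \<open>auto simp flip: abs_le_square_iff intro: order_trans[OF _ abs_ge_self]\<close>)
  qed measurable
qed

lemma wasserstein_proj_square_integrable:
  fixes \<mu> \<nu> :: "'a::euclidean_space measure"
  assumes "\<mu> \<in> P2" "\<nu> \<in> P2"
  shows "integrable sphere_uniform (\<lambda>\<theta>. (wasserstein (proj_measure \<theta> \<mu>) (proj_measure \<theta> \<nu>))\<^sup>2)"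
proof (rule sphere_uniform_square_integrable)
  let ?L = "sqrt (\<integral>x. (norm x)\<^sup>2 \<partial>\<mu>) + sqrt (\<integral>x. (norm x)\<^sup>2 \<partial>\<nu>)"
  fix \<theta> :: 'a assume \<theta>: "norm \<theta> \<le> 1"
  have "?L * norm \<theta> \<le> ?L * 1" by (intro mult_left_mono \<theta>) auto
  then show "\<bar>wasserstein (proj_measure \<theta> \<mu>) (proj_measure \<theta> \<nu>)\<bar>
    \<le> wasserstein (proj_measure 0 \<mu>) (proj_measure 0 \<nu>) + ?L"
    using wasserstein_proj_lipschitz[OF assms, of \<theta> 0] wasserstein_real_nonneg[of "proj_measure \<theta> \<mu>" "proj_measure \<theta> \<nu>"]
    by (simp add: assms proj_measure_P2)
qed (rule wasserstein_proj_measurable[OF assms])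

lemma directional_moment_square_integrable:
  fixes \<mu> :: "'a::euclidean_space measure"
  assumes "\<mu> \<in> P2"
  shows "integrable sphere_uniform (\<lambda>\<theta>. (directional_moment \<mu> \<theta>)\<^sup>2)"
proof (rule sphere_uniform_square_integrable)
  fix \<theta> :: 'a assume \<theta>: "norm \<theta> \<le> 1"
  have "(\<integral>x. (x \<bullet> \<theta>)\<^sup>2 \<partial>\<mu>) \<le> (\<integral>x. (norm x)\<^sup>2 \<partial>\<mu>)"
  proof (intro integral_mono inner_square_integrable assms P2_integrable)
    show "(x \<bullet> \<theta>)\<^sup>2 \<le> (norm x)\<^sup>2" for x
      using Cauchy_Schwarz_ineq2[of x \<theta>] mult_left_mono[OF \<theta>, of "norm x"]
      by (simp flip: abs_le_square_iff)
  qed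
  then show "\<bar>directional_moment \<mu> \<theta>\<bar> \<le> sqrt (\<integral>x. (norm x)\<^sup>2 \<partial>\<mu>)"
    by (simp add: directional_moment_def)
qed (rule directional_moment_measurable[OF assms])

section \<open>Metric properties of \<open>SW\<close> and the Lipschitz map to directional
  moments\<close>

lemma SW_nonneg: "0 \<le> SW \<mu> \<nu>"
  by (simp add: SW_def)

lemma SW_self: "\<mu> \<in> P2 \<Longrightarrow> SW \<mu> \<mu> = 0"
  by (simp add: SW_def wasserstein_real_self proj_measure_P2)

lemma SW_commute: "\<mu> \<in> P2 \<Longrightarrow> \<nu> \<in> P2 \<Longrightarrow> SW \<mu> \<nu> = SW \<nu> \<mu>"
  unfolding SW_def by (subst wasserstein_real_commute) (auto simp: proj_measure_P2)

text \<open>The triangle inequality on the line holds in each direction; Minkowski's inequality on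
  the sphere then combines the directions.\<close>

lemma SW_triangle:
  fixes \<mu> \<nu> \<rho> :: "'a::euclidean_space measure"
  assumes "\<mu> \<in> P2" "\<nu> \<in> P2" "\<rho> \<in> P2"
  shows "SW \<mu> \<rho> \<le> SW \<mu> \<nu> + SW \<nu> \<rho>"
proof -
  let ?W = "\<lambda>\<mu> \<nu> \<theta>. wasserstein (proj_measure \<theta> \<mu>) (proj_measure \<theta> (\<nu> :: 'a measure))"
  note [measurable] = wasserstein_proj_measurable
  note i = wasserstein_proj_square_integrable
  have "SW \<mu> \<rho> \<le> sqrt (\<integral>\<theta>. (?W \<mu> \<nu> \<theta> + ?W \<nu> \<rho> \<theta>)\<^sup>2 \<partial>sphere_uniform)"
    unfolding SW_def
  proof (intro real_sqrt_le_mono integral_mono i assms)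
    show "integrable sphere_uniform (\<lambda>\<theta>. (?W \<mu> \<nu> \<theta> + ?W \<nu> \<rho> \<theta>)\<^sup>2)"
      by (rule L2_add_integrable) (use assms i in auto)
    show "(?W \<mu> \<rho> \<theta>)\<^sup>2 \<le> (?W \<mu> \<nu> \<theta> + ?W \<nu> \<rho> \<theta>)\<^sup>2" for \<theta>
      by (intro power_mono wasserstein_real_triangle wasserstein_real_nonneg proj_measure_P2 assms)
  qed
  also have "\<dots> \<le> SW \<mu> \<nu> + SW \<nu> \<rho>"
    unfolding SW_def by (rule L2_triangle) (use assms i in auto)
  finally show ?thesis .
qed

text \<open>In each direction the moments differ by at most the Wasserstein distance of the
  projections. Integrating the squares shows that \<mu> \<mapsto>
  \<open>directional_moment \<mu>\<close> is 1-Lipschitz into \<open>L\<^sup>2\<close> of the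
  sphere.\<close>

lemma directional_moment_diff_le_SW:
  fixes \<mu> \<nu> :: "'a::euclidean_space measure"
  assumes "\<mu> \<in> P2" "\<nu> \<in> P2"
  shows "(\<integral>\<theta>. (directional_moment \<mu> \<theta> - directional_moment \<nu> \<theta>)\<^sup>2 \<partial>sphere_uniform) \<le> (SW \<mu> \<nu>)\<^sup>2"
proof -
  note [measurable] = directional_moment_measurable
  have "(\<integral>\<theta>. (directional_moment \<mu> \<theta> - directional_moment \<nu> \<theta>)\<^sup>2 \<partial>sphere_uniform)
    \<le> (\<integral>\<theta>. (wasserstein (proj_measure \<theta> \<mu>) (proj_measure \<theta> \<nu>))\<^sup>2 \<partial>sphere_uniform)"
  proof (intro integral_mono wasserstein_proj_square_integrable assms)
    show "integrable sphere_uniform (\<lambda>\<theta>. (directional_moment \<mu> \<theta> - directional_moment \<nu> \<theta>)\<^sup>2)"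
      by (rule L2_diff_integrable) (use assms directional_moment_square_integrable in auto)
    show "(directional_moment \<mu> \<theta> - directional_moment \<nu> \<theta>)\<^sup>2
      \<le> (wasserstein (proj_measure \<theta> \<mu>) (proj_measure \<theta> \<nu>))\<^sup>2" for \<theta>
      using second_moment_diff_le_wasserstein[of "proj_measure \<theta> \<mu>" "proj_measure \<theta> \<nu>"]
        wasserstein_real_nonneg[of "proj_measure \<theta> \<mu>" "proj_measure \<theta> \<nu>"]
      by (simp add: assms proj_measure_P2 directional_moment_proj flip: abs_le_square_iff)
  qed
  then show ?thesis by (simp add: SW_def)
qed

section \<open>Symmetric two-point measures\<close>

definition fair_sign :: "real measure" where
  "fair_sign = measure_pmf (pmf_of_set {-1, 1})"

text \<open>As images of one random sign, any two such measures and their projections are coupled by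
  sharing the sign.\<close>

definition symmetric_pair :: "'a::euclidean_space \<Rightarrow> 'a measure" where
  "symmetric_pair a = distr fair_sign borel (\<lambda>s. s *\<^sub>R a)"

lemma fair_sign_measurable: "f \<in> borel_measurable fair_sign"
  by (simp add: fair_sign_def)

lemma integrable_fair_sign: "integrable fair_sign (f :: real \<Rightarrow> real)"
  unfolding fair_sign_def by (rule integrable_measure_pmf_finite) simp

lemma integral_fair_sign: "(\<integral>s. f s \<partial>fair_sign) = (f (-1) + f 1) / (2 :: real)"
  unfolding fair_sign_def by (subst integral_pmf_of_set) auto

text \<open>The law of a fair sign is symmetric. With nonnegative factors, a shared sign couples the
  larger points with each other and the smaller points with each other.\<close>

lemma distr_fair_sign_abs:
  "distr fair_sign borel (\<lambda>s. s * c) = distr fair_sign borel (\<lambda>s. s * \<bar>c :: real\<bar>)"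
proof (cases "c \<ge> 0")
  case False
  have "map_pmf uminus (pmf_of_set {-1, 1 :: real}) = pmf_of_set {-1, 1}"
    by (subst map_pmf_of_set_inj) (auto simp: insert_commute)
  then have "fair_sign = distr fair_sign (count_space UNIV) uminus"
    unfolding fair_sign_def by (metis map_pmf_rep_eq)
  then have "distr fair_sign borel (\<lambda>s. s * \<bar>c\<bar>) = distr (distr fair_sign (count_space UNIV) uminus) borel (\<lambda>s. s * \<bar>c\<bar>)"
    by simp
  also have "\<dots> = distr fair_sign borel (\<lambda>s. s * c)"
    using False by (subst distr_distr) (auto simp: comp_def fair_sign_def)
  finally show ?thesis by simp
qed simp

lemma symmetric_pair_P2: "symmetric_pair a \<in> P2"
proof -
  interpret prob_space fair_sign unfolding fair_sign_def by (rule prob_space_measure_pmf)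
  show ?thesis
    by (auto simp: P2_def symmetric_pair_def integrable_distr_eq fair_sign_measurable integrable_fair_sign
        intro!: prob_space_distr)
qed

lemma directional_moment_symmetric_pair: "directional_moment (symmetric_pair a) \<theta> = \<bar>a \<bullet> \<theta>\<bar>"
  unfolding directional_moment_def symmetric_pair_def
  by (subst integral_distr)
    (auto simp: fair_sign_measurable integral_fair_sign inner_measurable_P2)

text \<open>For the two pairs the bound \<open>directional_moment_diff_le_SW\<close> is attained:
  sharing the sign in direction \<theta> costs the square of \<open>\<bar>a \<bullet> \<theta>\<bar>
  - \<bar>b \<bullet> \<theta>\<bar>\<close>, the difference of the directional moments.\<close>

lemma SW_symmetric_pair_le:
  fixes a b :: "'a::euclidean_space"
  shows "(SW (symmetric_pair a) (symmetric_pair b))\<^sup>2 \<le>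
    (\<integral>\<theta>. (directional_moment (symmetric_pair a) \<theta> - directional_moment (symmetric_pair b) \<theta>)\<^sup>2 \<partial>sphere_uniform)"
proof -
  note [measurable] = directional_moment_measurable
  have proj: "proj_measure \<theta> (symmetric_pair c) = distr fair_sign borel (\<lambda>s. s * \<bar>c \<bullet> \<theta>\<bar>)" for c \<theta> :: 'a
    unfolding proj_measure_def symmetric_pair_def
    by (subst distr_distr) (auto simp: fair_sign_measurable inner_measurable_P2 comp_def distr_fair_sign_abs[symmetric])
  have le: "(wasserstein (proj_measure \<theta> (symmetric_pair a)) (proj_measure \<theta> (symmetric_pair b)))\<^sup>2
    \<le> (directional_moment (symmetric_pair a) \<theta> - directional_moment (symmetric_pair b) \<theta>)\<^sup>2" for \<theta>
  proof -
    have "wasserstein (proj_measure \<theta> (symmetric_pair a)) (proj_measure \<theta> (symmetric_pair b))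
      \<le> sqrt (\<integral>s. (dist (s * \<bar>a \<bullet> \<theta>\<bar>) (s * \<bar>b \<bullet> \<theta>\<bar>))\<^sup>2 \<partial>fair_sign)"
      unfolding proj by (rule wasserstein_le) (rule fair_sign_measurable)+
    also have "\<dots> = \<bar>\<bar>a \<bullet> \<theta>\<bar> - \<bar>b \<bullet> \<theta>\<bar>\<bar>"
      by (simp add: integral_fair_sign dist_real_def power2_commute)
    finally show ?thesis
      using wasserstein_real_nonneg[of "proj_measure \<theta> (symmetric_pair a)" "proj_measure \<theta> (symmetric_pair b)"]
      by (simp add: directional_moment_symmetric_pair symmetric_pair_P2 proj_measure_P2 flip: abs_le_square_iff)
  qed
  have "(SW (symmetric_pair a) (symmetric_pair b))\<^sup>2 = (\<integral>\<theta>. (wasserstein (proj_measure \<theta> (symmetric_pair a)) (proj_measure \<theta> (symmetric_pair b)))\<^sup>2 \<partial>sphere_uniform)"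
    by (simp add: SW_def)
  also have "\<dots> \<le> (\<integral>\<theta>. (directional_moment (symmetric_pair a) \<theta> - directional_moment (symmetric_pair b) \<theta>)\<^sup>2 \<partial>sphere_uniform)"
    by (intro integral_mono wasserstein_proj_square_integrable symmetric_pair_P2 le L2_diff_integrable)
      (auto simp: directional_moment_square_integrable symmetric_pair_P2)
  finally show ?thesis .
qed

section \<open>Differentiation of indefinite integrals\<close>

text \<open>Integrating from minus infinity avoids a choice of base point and makes
  \<open>primitive f\<close> the distribution function of the measure with density \<open>f\<close>
  when \<open>f\<close> is nonnegative and integrable.\<close>

definition primitive :: "(real \<Rightarrow> real) \<Rightarrow> real \<Rightarrow> real" where
  "primitive f y = (LINT r:{..y}|lborel. f r)"

lemma set_integrable_lborel:
  fixes f :: "real \<Rightarrow> real"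
  assumes "integrable lborel f" "A \<in> sets borel"
  shows "set_integrable lborel A f"
  using integrable_mult_indicator[of A lborel f] assms by (simp add: set_integrable_def)

lemma primitive_diff:
  assumes "integrable lborel f" "s \<le> t"
  shows "primitive f t - primitive f s = (LINT r:{s<..t}|lborel. f r)"
proof -
  have "{..t} = {..s} \<union> {s<..t}" using assms(2) by auto
  then have "primitive f t = (LINT r:{..s} \<union> {s<..t}|lborel. f r)" by (simp add: primitive_def)
  also have "\<dots> = primitive f s + (LINT r:{s<..t}|lborel. f r)"
    unfolding primitive_def by (rule set_integral_Un) (auto intro!: set_integrable_lborel assms)
  finally show ?thesis by simp
qed

lemma primitive_mono:
  assumes "integrable lborel f" "\<And>x. 0 \<le> f x" "s \<le> t"
  shows "primitive f s \<le> primitive f t"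
proof -
  have "0 \<le> (LINT r:{s<..t}|lborel. f r)"
    unfolding set_lebesgue_integral_def by (intro integral_nonneg_AE AE_I2) (simp add: assms(2))
  then show ?thesis using primitive_diff[OF assms(1,3)] by simp
qed

text \<open>The primitive is the distribution function of a measure that is absolutely continuous
  and therefore has no atoms.\<close>

lemma isCont_primitive:
  assumes f: "integrable lborel f" and nonneg: "\<And>x. 0 \<le> f x"
  shows "isCont (primitive f) x"
proof -
  have [measurable]: "f \<in> borel_measurable borel" using borel_measurable_integrable[OF f] by simp
  let ?M = "density lborel f"
  have em: "emeasure ?M A = ennreal (LINT r:A|lborel. f r)" if [measurable]: "A \<in> sets borel" for A
  proof -
    have "emeasure ?M A = (\<integral>\<^sup>+x. ennreal (indicator A x *\<^sub>R f x) \<partial>lborel)"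
      by (subst emeasure_density) (auto intro!: nn_integral_cong simp: indicator_def)
    also have "\<dots> = ennreal (LINT r:A|lborel. f r)"
      unfolding set_lebesgue_integral_def
      using set_integrable_lborel[OF f that] nonneg
      by (intro nn_integral_eq_integral) (auto simp: set_integrable_def)
    finally show ?thesis .
  qed
  have "finite_measure ?M"
    by (rule finite_measureI) (use em[of UNIV] in simp)
  then interpret finite_borel_measure ?M
    by (simp add: finite_borel_measure_def finite_borel_measure_axioms_def)
  have "cdf ?M = primitive f"
  proof
    fix y
    have "0 \<le> primitive f y"
      unfolding primitive_def set_lebesgue_integral_def
      by (intro integral_nonneg_AE AE_I2) (simp add: nonneg)
    then show "cdf ?M y = primitive f y"
      by (simp add: cdf_def measure_def em primitive_def)
  qed
  moreover have "{x} \<in> null_sets ?M"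
    using absolutely_continuousI_density[of f lborel] unfolding absolutely_continuous_def
    by (rule subsetD) (auto simp: null_sets_def)
  then have "measure ?M {x} = 0" by (simp add: measure_def null_setsD1)
  ultimately show ?thesis using isCont_cdf[of x] by simp
qed

lemma set_integral_cong_AE_set:
  fixes f :: "real \<Rightarrow> real"
  assumes f: "integrable lborel f" and [measurable]: "A \<in> sets borel" "B \<in> sets borel"
    and AE: "AE r in lborel. r \<in> A \<longleftrightarrow> r \<in> B"
  shows "(LINT r:A|lborel. f r) = (LINT r:B|lborel. f r)"
proof -
  have [measurable]: "f \<in> borel_measurable borel" using borel_measurable_integrable[OF f] by simp
  show ?thesis
    unfolding set_lebesgue_integral_def
  proof (rule integral_cong_AE)
    show "AE r in lborel. indicator A r *\<^sub>R f r = indicator B r *\<^sub>R f r"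
      using AE by eventually_elim (auto simp: indicator_def)
  qed measurable
qed

text \<open>This is Lebesgue differentiation along cubes with lower corner \<open>x\<close>, which
  on the line are the intervals to the right of \<open>x\<close>.\<close>

lemma primitive_right_deriv_AE:
  assumes f: "integrable lborel f"
  shows "AE x in lborel. ((\<lambda>h. (primitive f (x + h) - primitive f x) / h) \<longlongrightarrow> f x) (at_right 0)"
proof -
  have si: "set_integrable lborel {a..b} f" for a b by (intro set_integrable_lborel f) auto
  have "f integrable_on cbox a b" for a b
    using set_borel_integral_eq_integral(1)[OF si] by (simp add: cbox_interval)
  then obtain N where N: "negligible N" and
    lim: "\<And>x e. x \<notin> N \<Longrightarrow> 0 < e \<Longrightarrow> \<exists>d>0. \<forall>h. 0 < h \<and> h < d \<longrightarrow>
      norm (integral (cbox x (x + h *\<^sub>R One)) f /\<^sub>R h ^ DIM(real) - f x) < e"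
    using integrable_ccontinuous_explicit[of f] by metis
  have eq: "integral (cbox x (x + h *\<^sub>R One)) f = primitive f (x + h) - primitive f x" if "0 < h" for x h
  proof -
    have "integral (cbox x (x + h *\<^sub>R One)) f = (LINT r:{x..x+h}|lborel. f r)"
      using set_borel_integral_eq_integral(2)[OF si] by (simp add: cbox_interval)
    also have "\<dots> = (LINT r:{x<..x+h}|lborel. f r)"
    proof (rule set_integral_cong_AE_set)
      show "AE r in lborel. r \<in> {x..x+h} \<longleftrightarrow> r \<in> {x<..x+h}"
        using AE_lborel_singleton[of x] by eventually_elim auto
    qed (auto intro: f)
    finally show ?thesis using primitive_diff[OF f, of x "x + h"] that by simp
  qed
  have "AE x in lebesgue. x \<notin> N"
    using N by (simp add: negligible_iff_null_sets AE_not_in)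
  then have "AE x in lborel. x \<notin> N"
    by (simp add: AE_completion_iff)
  then show ?thesis
  proof eventually_elim
    case (elim x)
    show ?case
    proof (rule tendstoI)
      fix e :: real assume "0 < e"
      then obtain d where d: "d > 0" "\<And>h. 0 < h \<Longrightarrow> h < d \<Longrightarrow>
        norm (integral (cbox x (x + h *\<^sub>R One)) f /\<^sub>R h ^ DIM(real) - f x) < e"
        using lim[OF elim] by blast
      then have "dist ((primitive f (x + h) - primitive f x) / h) (f x) < e" if "0 < h" "h < d" for h
        using d(2)[OF that] unfolding eq[OF that(1)] by (simp add: dist_norm field_simps)
      then show "\<forall>\<^sub>F h in at_right 0. dist ((primitive f (x + h) - primitive f x) / h) (f x) < e"
        using d(1) unfolding eventually_at_right_field by (intro exI[of _ d]) auto
    qed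
  qed
qed

lemma AE_lborel_uminus:
  fixes P :: "real \<Rightarrow> bool"
  assumes "AE x in lborel. P x"
  shows "AE x in lborel. P (- x)"
proof -
  have "AE x in distr lborel borel uminus. P x" using assms unfolding lborel_distr_uminus .
  then show ?thesis by (rule AE_distrD[rotated]) simp
qed

text \<open>The left derivative at \<open>x\<close> is the right derivative at \<open>- x\<close>
  for the reflected integrand, and reflection preserves null sets.\<close>

lemma primitive_deriv_AE:
  assumes f: "integrable lborel f"
  shows "AE x in lborel. ((\<lambda>h. (primitive f (x + h) - primitive f x) / h) \<longlongrightarrow> f x) (at 0)"
proof -
  let ?g = "\<lambda>x. f (- x)"
  have g: "integrable lborel ?g"
  proof (rule integrable_distr[where T = uminus and f = f])
    show "integrable (distr lborel borel uminus) f" using f unfolding lborel_distr_uminus .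
  qed simp
  have refl: "primitive ?g (- x + h) - primitive ?g (- x) = primitive f x - primitive f (x - h)"
    if "0 < h" for x h
  proof -
    have "primitive f x - primitive f (x - h) = (LINT r:{x - h<..x}|lborel. f r)"
      using primitive_diff[OF f, of "x - h" x] that by simp
    also have "\<dots> = (\<integral>r. indicator {x - h<..x} r *\<^sub>R f r \<partial>distr lborel borel uminus)"
      unfolding set_lebesgue_integral_def by (simp add: lborel_distr_uminus)
    also have "\<dots> = (\<integral>r. indicator {x - h<..x} (- r) *\<^sub>R f (- r) \<partial>lborel)"
      using borel_measurable_integrable[OF f] by (intro integral_distr) auto
    also have "\<dots> = (LINT r:{- x<..- x + h}|lborel. ?g r)"
    proof -
      have "AE r in lborel. r \<in> {- x..<- x + h} \<longleftrightarrow> r \<in> {- x<..- x + h}"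
        using AE_lborel_singleton[of "- x"] AE_lborel_singleton[of "- x + h"]
        by eventually_elim auto
      from set_integral_cong_AE_set[OF g _ _ this]
      have "(LINT r:{- x..<- x + h}|lborel. ?g r) = (LINT r:{- x<..- x + h}|lborel. ?g r)" by simp
      moreover have "indicat_real {x - h<..x} (- r) = indicator {- x..<- x + h} r" for r
        by (auto simp: indicator_def)
      ultimately show ?thesis by (simp add: set_lebesgue_integral_def)
    qed
    finally show ?thesis using primitive_diff[OF g, of "- x" "- x + h"] that by simp
  qed
  from primitive_right_deriv_AE[OF f] AE_lborel_uminus[OF primitive_right_deriv_AE[OF g]]
  show ?thesis
  proof eventually_elim
    case (elim x)
    have "((\<lambda>h. (primitive f (x + h) - primitive f x) / h) \<longlongrightarrow> f x) (at_left 0)"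
    proof (subst filterlim_at_left_to_right, rule Lim_transform_eventually)
      show "((\<lambda>h. (primitive ?g (- x + h) - primitive ?g (- x)) / h) \<longlongrightarrow> f x) (at_right (- 0))"
        using elim(2) by simp
      show "\<forall>\<^sub>F h in at_right (- 0). (primitive ?g (- x + h) - primitive ?g (- x)) / h
        = (primitive f (x + - h) - primitive f x) / - h"
        unfolding eventually_at_right_field
      proof (intro exI[of _ 1] conjI allI impI)
        fix h :: real assume "- 0 < h"
        then show "(primitive ?g (- x + h) - primitive ?g (- x)) / h
          = (primitive f (x + - h) - primitive f x) / - h"
          using refl[of h x] by (simp add: divide_simps)
      qed simp
    qed
    then show ?case using elim(1) by (simp add: filterlim_split_at_real filterlim_split_at)
  qed
qed

lemma primitive_difference_quotient_AE:
  assumes f: "integrable lborel f"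
  shows "AE x in lborel. ((\<lambda>y. (primitive f y - primitive f x) / (y - x)) \<longlongrightarrow> f x) (at x)"
  using primitive_deriv_AE[OF f]
proof eventually_elim
  case (elim x)
  then show ?case by (subst filterlim_at_to_0) (simp add: add.commute)
qed

text \<open>
  With \<open>G\<close> the primitive of \<open>g\<close>, both \<open>G + \<phi>\<close> and \<open>G - \<phi>\<close> are nondecreasing, and their Stieltjes
  measures add up to the one with density \<open>2 g\<close>. Hence both have a density by Radon--Nikodym.
\<close>

lemma dominated_increment_imp_primitive:
  fixes \<phi> g :: "real \<Rightarrow> real"
  assumes g: "integrable lborel g" and nonneg: "\<And>x. 0 \<le> g x"
    and dom: "\<And>s t. s \<le> t \<Longrightarrow> \<bar>\<phi> t - \<phi> s\<bar> \<le> primitive g t - primitive g s"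
  obtains f where "integrable lborel f" "\<And>s t. \<phi> t - \<phi> s = primitive f t - primitive f s"
proof -
  let ?G = "primitive g"
  have [measurable]: "g \<in> borel_measurable borel" using borel_measurable_integrable[OF g] by simp
  \<comment> \<open>Stieltjes measures require right continuity; the increments of \<phi> are
    dominated by those of the continuous function \<open>?G\<close>.\<close>
  have rc: "continuous (at_right a) \<phi>" for a
    unfolding continuous_within
  proof (rule Lim_null_comparison[THEN Lim_null[THEN iffD2]])
    show "\<forall>\<^sub>F t in at_right a. norm (\<phi> t - \<phi> a) \<le> ?G t - ?G a"
      using dom by (auto simp: eventually_at_filter intro!: always_eventually)
    have "(?G \<longlongrightarrow> ?G a) (at_right a)"
      using isCont_primitive[OF g nonneg, of a] by (auto simp: isCont_def intro: filterlim_mono[OF _ order.refl at_le])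
    then show "((\<lambda>t. ?G t - ?G a) \<longlongrightarrow> 0) (at_right a)"
      by (rule LIM_zero)
  qed
  have rcG: "continuous (at_right a) ?G" for a
    using isCont_primitive[OF g nonneg, of a] by (rule continuous_at_imp_continuous_at_within)
  let ?P = "interval_measure (\<lambda>x. ?G x + \<phi> x)" and ?N = "interval_measure (\<lambda>x. ?G x - \<phi> x)"
  have P: "emeasure ?P {a<..b} = ennreal ((?G b + \<phi> b) - (?G a + \<phi> a))" if "a \<le> b" for a b
    by (rule emeasure_interval_measure_Ioc[OF that]) (use dom rc rcG in \<open>fastforce simp: abs_le_iff intro!: continuous_intros\<close>)+
  have N: "emeasure ?N {a<..b} = ennreal ((?G b - \<phi> b) - (?G a - \<phi> a))" if "a \<le> b" for a b
    by (rule emeasure_interval_measure_Ioc[OF that]) (use dom rc rcG in \<open>fastforce simp: abs_le_iff intro!: continuous_intros\<close>)+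
  let ?D = "density lborel (\<lambda>x. ennreal (2 * g x))"
  \<comment> \<open>The sum of the two Stieltjes measures, to be compared with \<open>?D\<close> on
    half-open intervals, which generate the Borel sets.\<close>
  let ?S = "measure_of UNIV (sets borel) (\<lambda>A. emeasure ?P A + emeasure ?N A)"
  have S: "emeasure ?S A = emeasure ?P A + emeasure ?N A" if "A \<in> sets borel" for A
  proof (rule emeasure_measure_of[OF refl])
    show "countably_additive (sets ?S) (\<lambda>A. emeasure ?P A + emeasure ?N A)"
    proof (rule countably_additiveI)
      fix F :: "nat \<Rightarrow> real set" assume F: "range F \<subseteq> sets ?S" "disjoint_family F"
      then show "(\<Sum>i. emeasure ?P (F i) + emeasure ?N (F i)) = emeasure ?P (\<Union>i. F i) + emeasure ?N (\<Union>i. F i)"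
        by (subst suminf_add[symmetric])
          (auto simp: suminf_emeasure[symmetric] image_subset_iff sets.sigma_sets_eq[of borel, simplified])
    qed
  qed (use that in \<open>auto simp: positive_def sets.sigma_sets_eq[of borel, simplified]\<close>)
  have gen: "sets borel = sigma_sets UNIV (range (\<lambda>(a, b). {a<..b::real}))"
    by (subst borel_sigma_sets_Ioc) (simp add: sets_measure_of)
  have sets_S: "sets ?S = sets borel"
    using sets.sigma_sets_eq[of "borel :: real measure"] by simp
  have DS: "?D = ?S"
  proof (rule measure_eqI_generator_eq)
    let ?E = "range (\<lambda>(a, b). {a<..b::real})"
    show "Int_stable ?E" by (auto simp: Int_stable_def)
    show "emeasure ?D X = emeasure ?S X" if "X \<in> ?E" for X
    proof -
      obtain a b where X: "X = {a<..b}" using \<open>X \<in> ?E\<close> by auto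
      show ?thesis
      proof (cases "a \<le> b")
        case True
        have "emeasure ?D X = (\<integral>\<^sup>+x. ennreal (indicator {a<..b} x *\<^sub>R (2 * g x)) \<partial>lborel)"
          unfolding X by (subst emeasure_density) (auto intro!: nn_integral_cong simp: indicator_def)
        also have "\<dots> = ennreal (LINT x:{a<..b}|lborel. 2 * g x)"
          unfolding set_lebesgue_integral_def
          using set_integrable_lborel[OF g, of "{a<..b}"] nonneg
          by (intro nn_integral_eq_integral) (auto simp: set_integrable_def mult.left_commute)
        also have "\<dots> = ennreal (2 * (?G b - ?G a))"
          using primitive_diff[OF g True] by simp
        also have "\<dots> = emeasure ?S X"
          using dom[OF True] True by (simp add: X S P N abs_le_iff flip: ennreal_plus)
        finally show ?thesis .
      qed (simp add: X)
    qed
    show "sets ?D = sigma_sets UNIV ?E"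
      using gen by simp
    show "sets ?S = sigma_sets UNIV ?E"
      using gen sets_S by (simp only:)
    show "range (\<lambda>i. {- real i<..real i}) \<subseteq> ?E" by auto
    show "(\<Union>i. {- real i<..real i}) = UNIV"
    proof safe
      fix x :: real
      obtain n where "\<bar>x\<bar> < real n" using reals_Archimedean2 by blast
      then show "x \<in> (\<Union>i. {- real i<..real i})" by (intro UN_I[of n]) auto
    qed simp
    show "emeasure ?D {- real i<..real i} \<noteq> \<infinity>" for i
    proof -
      have "emeasure ?D {- real i<..real i} \<le> emeasure ?D UNIV" by (intro emeasure_mono) auto
      also have "\<dots> = ennreal (\<integral>x. 2 * g x \<partial>lborel)"
        using g nonneg by (simp add: emeasure_density nn_integral_eq_integral)
      finally show ?thesis by (auto simp: top_unique)
    qed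
  qed auto
  \<comment> \<open>This comparison yields both the absolute continuity and the finite total mass of
    \<open>?P\<close>.\<close>
  have le: "emeasure ?P A \<le> emeasure ?D A" if "A \<in> sets borel" for A
    unfolding DS S[OF that] by simp
  have "absolutely_continuous lborel ?P"
    unfolding absolutely_continuous_def
  proof
    fix A :: "real set" assume "A \<in> null_sets lborel"
    then have "A \<in> null_sets ?D"
      using absolutely_continuousI_density[of "\<lambda>x. ennreal (2 * g x)" lborel]
      unfolding absolutely_continuous_def by auto
    with le[of A] show "A \<in> null_sets ?P" by (auto simp: null_sets_def)
  qed
  then obtain p where p [measurable]: "p \<in> borel_measurable lborel" and pP: "density lborel p = ?P"
    using sigma_finite_measure.Radon_Nikodym[OF sigma_finite_lborel, of ?P] by auto
  have "(\<integral>\<^sup>+x. p x \<partial>lborel) = emeasure ?P UNIV"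
    unfolding pP[symmetric] by (simp add: emeasure_density)
  also have "\<dots> \<le> ennreal (\<integral>x. 2 * g x \<partial>lborel)"
    using le[of UNIV] g nonneg by (simp add: emeasure_density nn_integral_eq_integral)
  finally have fin: "(\<integral>\<^sup>+x. p x \<partial>lborel) < \<infinity>" by (auto simp: less_top[symmetric] top_unique)
  have AE_fin: "AE x in lborel. p x \<noteq> \<infinity>"
    by (rule nn_integral_PInf_AE) (use fin in auto)
  have AE_p: "AE x in lborel. ennreal (enn2real (p x)) = p x"
    using AE_fin by eventually_elim (simp add: less_top)
  have ip: "integrable lborel (\<lambda>x. enn2real (p x))"
  proof (rule integrableI_nonneg)
    have "(\<integral>\<^sup>+x. ennreal (enn2real (p x)) \<partial>lborel) = (\<integral>\<^sup>+x. p x \<partial>lborel)"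
      by (rule nn_integral_cong_AE) (rule AE_p)
    then show "(\<integral>\<^sup>+x. ennreal (enn2real (p x)) \<partial>lborel) < \<infinity>" using fin by simp
  qed auto
  let ?p = "\<lambda>x. enn2real (p x)"
  \<comment> \<open>The function \<open>?p\<close> is the density of \<open>?G + \<phi>\<close>;
    subtracting \<open>g\<close> leaves a density for \<phi>.\<close>
  have inc: "\<phi> t - \<phi> s = primitive (\<lambda>x. ?p x - g x) t - primitive (\<lambda>x. ?p x - g x) s" if "s \<le> t" for s t
  proof -
    have "emeasure ?P {s<..t} = (\<integral>\<^sup>+x. p x * indicator {s<..t} x \<partial>lborel)"
      unfolding pP[symmetric] by (subst emeasure_density) auto
    also have "\<dots> = (\<integral>\<^sup>+x. ennreal (indicator {s<..t} x *\<^sub>R ?p x) \<partial>lborel)"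
      by (rule nn_integral_cong_AE) (use AE_p in eventually_elim, auto simp: indicator_def)
    also have "\<dots> = ennreal (LINT x:{s<..t}|lborel. ?p x)"
      unfolding set_lebesgue_integral_def
      using set_integrable_lborel[OF ip, of "{s<..t}"]
      by (intro nn_integral_eq_integral) (auto simp: set_integrable_def)
    finally have "ennreal ((?G t + \<phi> t) - (?G s + \<phi> s)) = ennreal (LINT x:{s<..t}|lborel. ?p x)"
      using P[OF that] by simp
    moreover have "0 \<le> (LINT x:{s<..t}|lborel. ?p x)"
      unfolding set_lebesgue_integral_def by (intro integral_nonneg_AE AE_I2) simp
    ultimately have "(?G t + \<phi> t) - (?G s + \<phi> s) = (LINT x:{s<..t}|lborel. ?p x)"
      using dom[OF that] by (simp add: abs_le_iff)
    moreover have "(LINT x:{s<..t}|lborel. ?p x - g x) = (LINT x:{s<..t}|lborel. ?p x) - (LINT x:{s<..t}|lborel. g x)"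
      by (intro set_integral_diff set_integrable_lborel ip g) auto
    ultimately show ?thesis
      using primitive_diff[OF _ that, of "\<lambda>x. ?p x - g x"] primitive_diff[OF g that] ip g by simp
  qed
  show thesis
  proof (rule that)
    show "integrable lborel (\<lambda>x. ?p x - g x)" using ip g by simp
    show "\<phi> t - \<phi> s = primitive (\<lambda>x. ?p x - g x) t - primitive (\<lambda>x. ?p x - g x) s" for s t
      using inc[of s t] inc[of t s] by (cases "s \<le> t") auto
  qed
qed

section \<open>Existence of the metric derivative\<close>

lemma primitive_mono_integrand:
  assumes "integrable lborel f" "integrable lborel g" "AE x in lborel. f x \<le> g x" "s \<le> t"
  shows "primitive f t - primitive f s \<le> primitive g t - primitive g s"
proof -
  have "(LINT r:{s<..t}|lborel. f r) \<le> (LINT r:{s<..t}|lborel. g r)"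
    unfolding set_lebesgue_integral_def
  proof (rule integral_mono_AE)
    show "integrable lborel (\<lambda>x. indicator {s<..t} x *\<^sub>R f x)" "integrable lborel (\<lambda>x. indicator {s<..t} x *\<^sub>R g x)"
      using set_integrable_lborel assms(1,2) by (simp_all add: set_integrable_def)
    show "AE x in lborel. indicator {s<..t} x *\<^sub>R f x \<le> indicator {s<..t} x *\<^sub>R g x"
      using assms(3) by eventually_elim (auto simp: indicator_def)
  qed
  then show ?thesis by (simp add: primitive_diff assms)
qed

lemma primitive_abs_diff_le:
  assumes "integrable lborel f" "s \<le> t"
  shows "\<bar>primitive f t - primitive f s\<bar> \<le> primitive (\<lambda>x. \<bar>f x\<bar>) t - primitive (\<lambda>x. \<bar>f x\<bar>) s"
proof -
  have "primitive (\<lambda>x. - f x) y = - primitive f y" for y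
    by (simp add: primitive_def set_lebesgue_integral_def)
  then show ?thesis
    using primitive_mono_integrand[of f "\<lambda>x. \<bar>f x\<bar>" s t] primitive_mono_integrand[of "\<lambda>x. - f x" "\<lambda>x. \<bar>f x\<bar>" s t] assms
    by (auto simp: abs_le_iff)
qed

text \<open>Here \<open>H s t\<close> is the distance of two points of a curve and \<open>m\<close>
  its metric derivative. Each section \<open>H q\<close> has dominated increments, hence a density,
  and \<open>m\<close> is the supremum of the absolute densities over rational \<open>q\<close>. The
  sections bound \<open>H\<close> from below; letting \<open>q\<close> tend to \<open>s\<close>
  shows that the primitive of \<open>m\<close> bounds it from above.\<close>

lemma metric_speed_exists:
  fixes H :: "real \<Rightarrow> real \<Rightarrow> real" and g :: "real \<Rightarrow> real"
  assumes g: "integrable lborel g" and g0: "\<And>x. 0 \<le> g x"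
    and sym: "\<And>s t. H s t = H t s" and tri: "\<And>s t u. H s u \<le> H s t + H t u"
    and dom: "\<And>s t. s \<le> t \<Longrightarrow> H s t \<le> primitive g t - primitive g s"
  obtains m where "integrable lborel m" "\<And>x. 0 \<le> m x"
    "AE t in lborel. ((\<lambda>s. H s t / \<bar>s - t\<bar>) \<longlongrightarrow> m t) (at t)"
    "\<And>s t. s \<le> t \<Longrightarrow> H s t \<le> primitive m t - primitive m s"
proof -
  have Hdiff: "\<bar>H q t - H q s\<bar> \<le> H s t" for q s t
    using tri[of q t s] tri[of q s t] sym[of s t] by simp
  define r :: "nat \<Rightarrow> real" where "r = from_nat_into \<rat>"
  have r: "range r = \<rat>"
    unfolding r_def by (intro range_from_nat_into countable_rat) (auto intro: Rats_0)
  have "\<exists>f. integrable lborel f \<and> (\<forall>s t. H (r n) t - H (r n) s = primitive f t - primitive f s)" for n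
    by (rule dominated_increment_imp_primitive[OF g g0, of "H (r n)"]) (use order_trans[OF Hdiff dom] in auto)
  then obtain f where f: "\<And>n. integrable lborel (f n)"
    and inc: "\<And>n s t. H (r n) t - H (r n) s = primitive (f n) t - primitive (f n) s"
    by metis
  have le_speed: "\<bar>primitive (f n) s - primitive (f n) t\<bar> / \<bar>s - t\<bar> \<le> H s t / \<bar>s - t\<bar>" for n s t
    using Hdiff[of "r n" t s] inc[of n s t] sym[of s t] by (intro divide_right_mono) auto
  have abs_quot: "((\<lambda>s. \<bar>primitive h s - primitive h t\<bar> / \<bar>s - t\<bar>) \<longlongrightarrow> \<bar>h t\<bar>) (at t)"
    if "((\<lambda>s. (primitive h s - primitive h t) / (s - t)) \<longlongrightarrow> h t) (at t)" for h t
    using tendsto_rabs[OF that] by (simp add: abs_divide)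
  have H_le_g: "H s t / \<bar>s - t\<bar> \<le> \<bar>primitive g s - primitive g t\<bar> / \<bar>s - t\<bar>" for s t
    using dom[of s t] dom[of t s] sym[of s t] by (intro divide_right_mono) (cases "s \<le> t"; auto)+
  have "AE t in lborel. \<bar>f n t\<bar> \<le> g t" for n
    using primitive_difference_quotient_AE[OF f, of n] primitive_difference_quotient_AE[OF g]
  \<comment> \<open>By \<open>le_speed\<close> and \<open>H_le_g\<close> the difference quotients
    are ordered, and so are their limits.\<close>
  proof eventually_elim
    case (elim t)
    have "\<bar>f n t\<bar> \<le> \<bar>g t\<bar>"
      by (rule tendsto_le[OF _ abs_quot[of g, OF elim(2)] abs_quot[of "f n", OF elim(1)]])
        (use order_trans[OF le_speed H_le_g] in auto)
    then show ?case using g0[of t] by simp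
  qed
  then have f_le_g: "AE t in lborel. \<forall>n. \<bar>f n t\<bar> \<le> g t" by (simp add: AE_all_countable)
  have [measurable]: "g \<in> borel_measurable lborel" "f n \<in> borel_measurable lborel" for n
    using g f by (auto dest: borel_measurable_integrable)
  \<comment> \<open>the truncation by \<open>g\<close> keeps the supremum bounded on the exceptional null set as well\<close>
  define m where "m t = (SUP n. min \<bar>f n t\<bar> (g t))" for t
  have bdd: "bdd_above (range (\<lambda>n. min \<bar>f n t\<bar> (g t)))" for t
    by (rule bdd_aboveI[of _ "g t"]) auto
  have m_ge: "min \<bar>f n t\<bar> (g t) \<le> m t" for n t
    unfolding m_def by (rule cSUP_upper[OF _ bdd]) simp
  have m_le_g: "m t \<le> g t" for t
    unfolding m_def by (rule cSUP_least) auto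
  have m0: "0 \<le> m t" for t
    using m_ge[of 0 t] g0[of t] by (auto simp: min_def split: if_splits)
  have [measurable]: "m \<in> borel_measurable lborel"
    unfolding m_def by (rule borel_measurable_cSUP) (use bdd in auto)
  have m: "integrable lborel m"
    by (rule Bochner_Integration.integrable_bound[OF g]) (use m0 m_le_g g0 in auto)
  have f_le_m: "AE t in lborel. \<forall>n. \<bar>f n t\<bar> \<le> m t"
    using f_le_g by eventually_elim (metis m_ge min.absorb1)
  have H_le_m: "H s t \<le> primitive m t - primitive m s" if "s \<le> t" for s t
  proof (rule field_le_epsilon)
    fix e :: real assume "0 < e"
    \<comment> \<open>For a rational \<open>q\<close> slightly to the right of \<open>s\<close>,
      twice \<open>H q s\<close> is less than \<open>e\<close>, and \<open>H s t\<close> exceeds the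
      increment \<open>H q t - H q s\<close> by at most that amount.\<close>
    have "isCont (primitive g) s" by (rule isCont_primitive[OF g g0])
    then obtain d where d: "d > 0" "\<And>q. \<bar>q - s\<bar> < d \<Longrightarrow> \<bar>primitive g q - primitive g s\<bar> < e / 2"
      using \<open>0 < e\<close> unfolding continuous_at_eps_delta dist_real_def by (metis half_gt_zero)
    obtain q where q: "q \<in> \<rat>" "s < q" "q < s + d" using Rats_dense_in_real[of s "s + d"] d(1) by auto
    then obtain n where n: "q = r n" using r by (metis imageE)
    have "\<bar>primitive g q - primitive g s\<bar> < e / 2" using q by (intro d(2)) simp
    moreover have "H q s \<le> primitive g q - primitive g s" using dom[of s q] q sym[of q s] by simp
    ultimately have "H q s < e / 2" by linarith
    have "H q t - H q s \<le> primitive (\<lambda>x. \<bar>f n x\<bar>) t - primitive (\<lambda>x. \<bar>f n x\<bar>) s"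
      using primitive_abs_diff_le[OF f that, of n] inc[of n t s] n by auto
    also have "\<dots> \<le> primitive m t - primitive m s"
      by (rule primitive_mono_integrand) (use f m that f_le_m in auto)
    finally show "H s t \<le> primitive m t - primitive m s + e"
      using tri[of s t q] sym[of s q] \<open>H q s < e / 2\<close> by linarith
  qed
  have H_le_m': "H s t / \<bar>s - t\<bar> \<le> \<bar>primitive m s - primitive m t\<bar> / \<bar>s - t\<bar>" for s t
    using H_le_m[of s t] H_le_m[of t s] sym[of s t] by (intro divide_right_mono) (cases "s \<le> t"; auto)+
  have "AE t in lborel. \<forall>n. ((\<lambda>s. (primitive (f n) s - primitive (f n) t) / (s - t)) \<longlongrightarrow> f n t) (at t)"
    unfolding AE_all_countable using primitive_difference_quotient_AE[OF f] by blast
  then have "AE t in lborel. ((\<lambda>s. H s t / \<bar>s - t\<bar>) \<longlongrightarrow> m t) (at t)"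
    using primitive_difference_quotient_AE[OF m]
  proof eventually_elim
    case (elim t)
    show ?case
    proof (rule order_tendstoI)
      \<comment> \<open>A single section whose density exceeds \<open>a\<close> already keeps the
        quotient of \<open>H\<close> above \<open>a\<close> near \<open>t\<close>.\<close>
      fix a assume "a < m t"
      then obtain n where "a < min \<bar>f n t\<bar> (g t)"
        unfolding m_def by (subst (asm) less_cSUP_iff) (use bdd in auto)
      then have "a < \<bar>f n t\<bar>" by simp
      then have "\<forall>\<^sub>F s in at t. a < \<bar>primitive (f n) s - primitive (f n) t\<bar> / \<bar>s - t\<bar>"
        by (rule order_tendstoD(1)[OF abs_quot[of "f n", OF elim(1)[rule_format]]])
      then show "\<forall>\<^sub>F s in at t. a < H s t / \<bar>s - t\<bar>"
        by eventually_elim (use le_speed less_le_trans in blast)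
    next
      fix a assume "m t < a"
      then have "\<bar>m t\<bar> < a" using m0[of t] by simp
      then have "\<forall>\<^sub>F s in at t. \<bar>primitive m s - primitive m t\<bar> / \<bar>s - t\<bar> < a"
        by (rule order_tendstoD(2)[OF abs_quot[of m, OF elim(2)]])
      then show "\<forall>\<^sub>F s in at t. H s t / \<bar>s - t\<bar> < a"
        by eventually_elim (use H_le_m' le_less_trans in blast)
    qed
  qed
  from that[OF m m0 this H_le_m] show thesis .
qed

section \<open>Lengths and midpoints of absolutely continuous curves\<close>

lemma abs_cont_curve_primitive:
  assumes c: "abs_cont_curve X d c"
  obtains g where "integrable lborel g" "\<And>x. 0 \<le> g x"
    "\<And>s t. 0 \<le> s \<Longrightarrow> s \<le> t \<Longrightarrow> t \<le> 1 \<Longrightarrow> d (c s) (c t) \<le> primitive g t - primitive g s"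
proof -
  obtain g0 where g0: "set_integrable lborel {0<..<1} g0"
    and le: "\<And>s t. 0 \<le> s \<Longrightarrow> s \<le> t \<Longrightarrow> t \<le> 1 \<Longrightarrow> d (c s) (c t) \<le> (LINT r:{s<..<t}|lborel. g0 r)"
    using c unfolding abs_cont_curve_def by blast
  \<comment> \<open>Extending by zero and taking absolute values gives a nonnegative integrable
    function on the whole line.\<close>
  define g where "g x = \<bar>indicator {0<..<1} x * g0 x\<bar>" for x
  have g: "integrable lborel g"
    using g0 unfolding g_def set_integrable_def by simp
  show thesis
  proof (rule that[OF g])
    show "0 \<le> g x" for x by (simp add: g_def)
    fix s t :: real assume st: "0 \<le> s" "s \<le> t" "t \<le> 1"
    have "(LINT r:{s<..<t}|lborel. g0 r) \<le> (LINT r:{s<..t}|lborel. g r)"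
      unfolding set_lebesgue_integral_def
    proof (rule integral_mono)
      have "set_integrable lborel {s<..<t} g0" by (rule set_integrable_subset[OF g0]) (use st in auto)
      then show "integrable lborel (\<lambda>x. indicator {s<..<t} x *\<^sub>R g0 x)" by (simp add: set_integrable_def)
      show "integrable lborel (\<lambda>x. indicator {s<..t} x *\<^sub>R g x)"
        using set_integrable_lborel[OF g, of "{s<..t}"] by (simp add: set_integrable_def)
      show "indicator {s<..<t} x *\<^sub>R g0 x \<le> indicator {s<..t} x *\<^sub>R g x" for x
        using st by (auto simp: g_def indicator_def)
    qed
    then show "d (c s) (c t) \<le> primitive g t - primitive g s"
      using le[OF st] primitive_diff[OF g st(2)] by simp
  qed
qed

text \<open>The length is the integral of the speed \<open>m\<close> over the unit interval. The
  primitive of \<open>m\<close> bounds the distance on either side of \<tau>, and the two increments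
  add up to this integral.\<close>

lemma abs_cont_curve_length_ge:
  assumes c: "abs_cont_curve X d c"
    and sym: "\<And>x y. x \<in> X \<Longrightarrow> y \<in> X \<Longrightarrow> d x y = d y x"
    and tri: "\<And>x y z. x \<in> X \<Longrightarrow> y \<in> X \<Longrightarrow> z \<in> X \<Longrightarrow> d x z \<le> d x y + d y z"
    and \<tau>: "0 \<le> \<tau>" "\<tau> \<le> 1"
  shows "ennreal (d (c 0) (c \<tau>) + d (c \<tau>) (c 1)) \<le> (\<integral>\<^sup>+ t\<in>{0..1}. ennreal (metric_deriv d c t) \<partial>lborel)"
proof -
  obtain g where g: "integrable lborel g" and g0: "\<And>x. 0 \<le> g x"
    and dom: "\<And>s t. 0 \<le> s \<Longrightarrow> s \<le> t \<Longrightarrow> t \<le> 1 \<Longrightarrow> d (c s) (c t) \<le> primitive g t - primitive g s"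
    using abs_cont_curve_primitive[OF c] by blast
  \<comment> \<open>Clamping the parameter extends the curve by constants to the whole line, where
    \<open>metric_speed_exists\<close> applies.\<close>
  define p :: "real \<Rightarrow> real" where "p t = max 0 (min 1 t)" for t
  have p01: "0 \<le> p t" "p t \<le> 1" for t by (auto simp: p_def)
  have p_id: "p t = t" if "0 \<le> t" "t \<le> 1" for t using that by (auto simp: p_def)
  have cX: "c (p t) \<in> X" for t using c p01 by (auto simp: abs_cont_curve_def)
  have domH: "d (c (p s)) (c (p t)) \<le> primitive g t - primitive g s" if "s \<le> t" for s t
  proof (cases "p s = p t")
    case True
    have "d (c (p s)) (c (p t)) \<le> 0" using dom[of "p s" "p s"] p01 True by simp
    then show ?thesis using primitive_mono[OF g g0 that] by simp
  next
    case False
    then have "p s \<le> p t" "s \<le> p s" "p t \<le> t" using that by (auto simp: p_def)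
    then show ?thesis
      using dom[of "p s" "p t"] p01 primitive_mono[OF g g0, of s "p s"] primitive_mono[OF g g0, of "p t" t]
      by fastforce
  qed
  obtain m where m: "integrable lborel m" and m0: "\<And>x. 0 \<le> m x"
    and lim: "AE t in lborel. ((\<lambda>s. d (c (p s)) (c (p t)) / \<bar>s - t\<bar>) \<longlongrightarrow> m t) (at t)"
    and le_m: "\<And>s t. s \<le> t \<Longrightarrow> d (c (p s)) (c (p t)) \<le> primitive m t - primitive m s"
    by (rule metric_speed_exists[OF g g0, of "\<lambda>s t. d (c (p s)) (c (p t))"])
      (use sym tri cX domH in auto)
  have deriv: "AE t in lborel. 0 < t \<and> t < 1 \<longrightarrow> metric_deriv d c t = m t"
    using lim
  proof eventually_elim
    case (elim t)
    show ?case
    proof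
      assume t: "0 < t \<and> t < 1"
      have "((\<lambda>s. d (c s) (c t) / \<bar>s - t\<bar>) \<longlongrightarrow> m t) (at t)"
      proof (rule Lim_transform_eventually[OF elim])
        have "\<forall>\<^sub>F s in at t. s \<in> {0<..<1}"
          using t by (intro eventually_at_in_open') auto
        then show "\<forall>\<^sub>F s in at t. d (c (p s)) (c (p t)) / \<bar>s - t\<bar> = d (c s) (c t) / \<bar>s - t\<bar>"
          by eventually_elim (use t in \<open>simp add: p_id\<close>)
      qed
      moreover have "at t within {0..1} = at t"
        using t by (intro at_within_interior) auto
      ultimately show "metric_deriv d c t = m t"
        unfolding metric_deriv_def by (intro tendsto_Lim) auto
    qed
  qed
  have "d (c 0) (c \<tau>) + d (c \<tau>) (c 1) \<le> primitive m 1 - primitive m 0"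
    using le_m[of 0 \<tau>] le_m[of \<tau> 1] \<tau> by (simp add: p_id)
  also have "\<dots> = (LINT r:{0<..1}|lborel. m r)"
    by (simp add: primitive_diff[OF m])
  finally have "ennreal (d (c 0) (c \<tau>) + d (c \<tau>) (c 1)) \<le> ennreal (LINT r:{0<..1}|lborel. m r)"
    by (rule ennreal_leI)
  also have "\<dots> = (\<integral>\<^sup>+ t. ennreal (indicator {0<..1} t *\<^sub>R m t) \<partial>lborel)"
    unfolding set_lebesgue_integral_def
    using set_integrable_lborel[OF m, of "{0<..1}"] m0
    by (intro nn_integral_eq_integral[symmetric]) (auto simp: set_integrable_def)
  also have "\<dots> = (\<integral>\<^sup>+ t\<in>{0..1}. ennreal (metric_deriv d c t) \<partial>lborel)"
    by (rule nn_integral_cong_AE)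
      (use deriv AE_lborel_singleton[of 0] AE_lborel_singleton[of 1] in eventually_elim, auto simp: indicator_def)
  finally show ?thesis .
qed

text \<open>The distance from \<open>c 0\<close> varies continuously along the curve, so the
  intermediate value theorem applies. Only the distance to the starting point is halved; that to
  \<open>c 1\<close> is later controlled by the length.\<close>

lemma abs_cont_curve_midpoint:
  assumes c: "abs_cont_curve X d c"
    and sym: "\<And>x y. x \<in> X \<Longrightarrow> y \<in> X \<Longrightarrow> d x y = d y x"
    and tri: "\<And>x y z. x \<in> X \<Longrightarrow> y \<in> X \<Longrightarrow> z \<in> X \<Longrightarrow> d x z \<le> d x y + d y z"
    and nonneg: "\<And>x y. x \<in> X \<Longrightarrow> y \<in> X \<Longrightarrow> 0 \<le> d x y"
    and self: "\<And>x. x \<in> X \<Longrightarrow> d x x = 0"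
  obtains \<tau> where "0 \<le> \<tau>" "\<tau> \<le> 1" "d (c 0) (c \<tau>) = d (c 0) (c 1) / 2"
proof -
  obtain g where g: "integrable lborel g" and g0: "\<And>x. 0 \<le> g x"
    and dom: "\<And>s t. 0 \<le> s \<Longrightarrow> s \<le> t \<Longrightarrow> t \<le> 1 \<Longrightarrow> d (c s) (c t) \<le> primitive g t - primitive g s"
    using abs_cont_curve_primitive[OF c] by blast
  have cX: "c t \<in> X" if "0 \<le> t" "t \<le> 1" for t using c that by (auto simp: abs_cont_curve_def)
  have bound: "\<bar>d (c 0) (c s) - d (c 0) (c t)\<bar> \<le> \<bar>primitive g s - primitive g t\<bar>"
    if "0 \<le> s" "s \<le> 1" "0 \<le> t" "t \<le> 1" for s t
    using tri[of "c 0" "c s" "c t"] tri[of "c 0" "c t" "c s"] sym[of "c s" "c t"] cX that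
      dom[of s t] dom[of t s] by (cases "s \<le> t") (auto simp: abs_le_iff)
  have "continuous_on {0..1} (\<lambda>t. d (c 0) (c t))"
    unfolding continuous_on_def
  proof
    fix t :: real assume t: "t \<in> {0..1}"
    have "((\<lambda>s. primitive g s - primitive g t) \<longlongrightarrow> 0) (at t within {0..1})"
      using isCont_primitive[OF g g0, of t] by (intro LIM_zero) (auto simp: isCont_def intro: tendsto_within_subset)
    then have "((\<lambda>s. \<bar>primitive g s - primitive g t\<bar>) \<longlongrightarrow> 0) (at t within {0..1})"
      by (rule tendsto_rabs_zero)
    then have "((\<lambda>s. d (c 0) (c s) - d (c 0) (c t)) \<longlongrightarrow> 0) (at t within {0..1})"
      by (rule Lim_null_comparison[rotated]) (use bound t in \<open>auto simp: eventually_at_filter\<close>)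
    then show "((\<lambda>t. d (c 0) (c t)) \<longlongrightarrow> d (c 0) (c t)) (at t within {0..1})"
      by (rule LIM_zero_cancel)
  qed
  then have "\<exists>\<tau>. 0 \<le> \<tau> \<and> \<tau> \<le> 1 \<and> d (c 0) (c \<tau>) = d (c 0) (c 1) / 2"
    by (intro IVT') (use self cX nonneg[of "c 0" "c 1"] in auto)
  then show thesis using that by blast
qed

section \<open>Approximate midpoints and quadratic forms\<close>

text \<open>Along any line the squared moment is a polynomial of degree at most two in the
  parameter.\<close>

lemma directional_moment_third_difference:
  assumes "m \<in> P2"
  shows "(directional_moment m (x + 3 *\<^sub>R v))\<^sup>2 - 3 * (directional_moment m (x + 2 *\<^sub>R v))\<^sup>2
    + 3 * (directional_moment m (x + v))\<^sup>2 - (directional_moment m x)\<^sup>2 = 0"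
proof -
  have sq: "(directional_moment m \<theta>)\<^sup>2 = (\<integral>y. (y \<bullet> \<theta>)\<^sup>2 \<partial>m)" for \<theta>
    by (simp add: directional_moment_def)
  have "(\<integral>y. (y \<bullet> (x + 3 *\<^sub>R v))\<^sup>2 \<partial>m)
    = (\<integral>y. 3 * (y \<bullet> (x + 2 *\<^sub>R v))\<^sup>2 - 3 * (y \<bullet> (x + v))\<^sup>2 + (y \<bullet> x)\<^sup>2 \<partial>m)"
    by (intro Bochner_Integration.integral_cong)
      (auto simp: inner_add_right power2_eq_square algebra_simps)
  also have "\<dots> = 3 * (\<integral>y. (y \<bullet> (x + 2 *\<^sub>R v))\<^sup>2 \<partial>m) - 3 * (\<integral>y. (y \<bullet> (x + v))\<^sup>2 \<partial>m) + (\<integral>y. (y \<bullet> x)\<^sup>2 \<partial>m)"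
    using inner_square_integrable[OF assms] by simp
  finally show ?thesis unfolding sq by simp
qed

text \<open>With \<alpha> and \<beta> standing for \<open>a \<bullet> x\<close> and
  \<open>b \<bullet> x\<close>, the constant and quadratic terms drop out of the third difference.
  What remains is \<open>\<alpha> * D / 2\<close>, where \<open>D\<close> is the third difference of
  the absolute value across its kink.\<close>

lemma l1_square_third_difference_le:
  fixes \<alpha> \<beta> :: real
  assumes "7 / 32 \<le> \<alpha>" "\<bar>\<beta> + 1 / 8\<bar> \<le> 1 / 32"
  shows "((\<alpha> + \<bar>\<beta> + 3 / 8\<bar>) / 2)\<^sup>2 - 3 * ((\<alpha> + \<bar>\<beta> + 2 / 8\<bar>) / 2)\<^sup>2
    + 3 * ((\<alpha> + \<bar>\<beta> + 1 / 8\<bar>) / 2)\<^sup>2 - ((\<alpha> + \<bar>\<beta>\<bar>) / 2)\<^sup>2 \<le> - 7 / 512"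
proof -
  define D where "D = \<bar>\<beta> + 3 / 8\<bar> - 3 * \<bar>\<beta> + 2 / 8\<bar> + 3 * \<bar>\<beta> + 1 / 8\<bar> - \<bar>\<beta>\<bar>"
  have sq: "((\<alpha> + \<bar>t\<bar>) / 2)\<^sup>2 = \<alpha> * \<alpha> / 4 + \<alpha> * \<bar>t\<bar> / 2 + t * t / 4" for t :: real
    by (simp add: power2_eq_square algebra_simps)
  have "((\<alpha> + \<bar>\<beta> + 3 / 8\<bar>) / 2)\<^sup>2 - 3 * ((\<alpha> + \<bar>\<beta> + 2 / 8\<bar>) / 2)\<^sup>2
    + 3 * ((\<alpha> + \<bar>\<beta> + 1 / 8\<bar>) / 2)\<^sup>2 - ((\<alpha> + \<bar>\<beta>\<bar>) / 2)\<^sup>2 = \<alpha> * D / 2"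
    unfolding sq D_def by (simp add: field_simps)
  \<comment> \<open>With \<delta> = \<beta> + 1/8 one gets
    \<open>D = - 1 / 4 - \<delta> + 3 * \<bar>\<delta>\<bar>\<close>, and \<delta> is at most 1/32
    in absolute value.\<close>
  moreover have "D \<le> - 1 / 8"
  proof -
    have *: "- (1 / 32) \<le> \<beta> + 1 / 8" "\<beta> + 1 / 8 \<le> 1 / 32" using assms(2) unfolding abs_le_iff by linarith+
    then have signs: "\<bar>\<beta> + 3 / 8\<bar> = \<beta> + 3 / 8" "\<bar>\<beta> + 2 / 8\<bar> = \<beta> + 2 / 8" "\<bar>\<beta>\<bar> = - \<beta>" by simp_all
    show ?thesis unfolding D_def signs using * assms(2) by simp
  qed
  then have "\<alpha> * (1 / 8) \<le> \<alpha> * (- D)" using assms(1) by (intro mult_left_mono) auto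
  ultimately show ?thesis using assms(1) by simp
qed

lemma square_diff_le:
  fixes N h \<epsilon> :: real
  assumes "\<bar>N - h\<bar> \<le> \<epsilon>" "0 \<le> h" "h \<le> 1" "\<epsilon> \<le> 1"
  shows "\<bar>N\<^sup>2 - h\<^sup>2\<bar> \<le> 3 * \<epsilon>"
proof -
  have "\<bar>N\<^sup>2 - h\<^sup>2\<bar> = \<bar>N + h\<bar> * \<bar>N - h\<bar>"
    by (simp add: power2_eq_square algebra_simps flip: abs_mult)
  \<comment> \<open>The first factor is at most \<open>2 * h + \<epsilon>\<close>, hence at most
    3.\<close>
  also have "\<dots> \<le> 3 * \<epsilon>" using assms by (intro mult_mono) auto
  finally show ?thesis .
qed

text \<open>
  The squared directional moments are quadratic forms and have vanishing third differences, whereas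
  the third difference of \<open>(\<bar>a \<bullet> x\<bar> + \<bar>b \<bullet> x\<bar>)\<^sup>2\<close> across the hyperplane \<open>b \<bullet> x = 0\<close> does not vanish.
  The constant \<open>\<epsilon> = 1 / 2000\<close> satisfies \<open>8 \<cdot> 3 \<epsilon> < 7 / 512\<close>, where 8 is the sum of the absolute
  values of the coefficients of the third difference.
\<close>

lemma directional_moment_not_l1_pointwise:
  fixes a b x :: "'a::euclidean_space"
  assumes m: "m \<in> P2" and ab: "a \<in> Basis" "b \<in> Basis" "a \<noteq> b"
    and x: "x \<in> ball ((1 / 4) *\<^sub>R a - (1 / 8) *\<^sub>R b) (1 / 32)"
  shows "(1 / 2000)\<^sup>2 \<le> (\<Sum>j<4. (directional_moment m (x + (real j / 8) *\<^sub>R b)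
    - (\<bar>a \<bullet> (x + (real j / 8) *\<^sub>R b)\<bar> + \<bar>b \<bullet> (x + (real j / 8) *\<^sub>R b)\<bar>) / 2)\<^sup>2)"
proof (rule ccontr)
  define p where "p j = x + (real j / 8) *\<^sub>R b" for j :: nat
  define h where "h j = (\<bar>a \<bullet> p j\<bar> + \<bar>b \<bullet> p j\<bar>) / 2" for j
  define N where "N j = directional_moment m (p j)" for j
  assume "\<not> ?thesis"
  then have less: "(\<Sum>j<4. (N j - h j)\<^sup>2) < (1 / 2000)\<^sup>2"
    by (simp add: p_def h_def N_def)
  have close: "\<bar>N j - h j\<bar> \<le> 1 / 2000" if "j < 4" for j
  proof -
    have "(N j - h j)\<^sup>2 \<le> (\<Sum>j<4. (N j - h j)\<^sup>2)"
      using that by (intro member_le_sum) auto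
    then have "(N j - h j)\<^sup>2 \<le> (1 / 2000)\<^sup>2" using less by linarith
    then show ?thesis by (simp flip: abs_le_square_iff)
  qed
  have ortho: "a \<bullet> b = 0" "b \<bullet> a = 0" "a \<bullet> a = 1" "b \<bullet> b = 1"
    using ab by (auto simp: inner_Basis)
  \<comment> \<open>The offset from the centre changes both coordinates by at most 1/32, so
    \<open>a \<bullet> x \<ge> 7 / 32\<close> and \<open>b \<bullet> x\<close> stays within 1/32 of
    -1/8.\<close>
  define z where "z = x - ((1 / 4) *\<^sub>R a - (1 / 8) *\<^sub>R b)"
  have "norm z < 1 / 32" using x by (simp add: z_def dist_norm norm_minus_commute)
  then have z: "\<bar>a \<bullet> z\<bar> \<le> 1 / 32" "\<bar>b \<bullet> z\<bar> \<le> 1 / 32"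
    using Cauchy_Schwarz_ineq2[of a z] Cauchy_Schwarz_ineq2[of b z] ab by auto
  have \<alpha>: "a \<bullet> x = 1 / 4 + a \<bullet> z" and \<beta>: "b \<bullet> x = - 1 / 8 + b \<bullet> z"
    by (simp_all add: z_def inner_diff_right ortho)
  have h: "h j = (a \<bullet> x + \<bar>b \<bullet> x + real j / 8\<bar>) / 2" for j
    using z \<alpha> by (simp add: h_def p_def inner_add_right ortho)
  have h01: "0 \<le> h j" "h j \<le> 1" if "j < 4" for j
  proof -
    have "real j \<le> 3" using that by simp
    then have "\<bar>b \<bullet> x + real j / 8\<bar> \<le> 1" using z \<beta> by (auto simp: abs_le_iff)
    moreover have "0 \<le> a \<bullet> x" "a \<bullet> x \<le> 1" using z \<alpha> by (auto simp: abs_le_iff)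
    ultimately have "0 \<le> (a \<bullet> x + \<bar>b \<bullet> x + real j / 8\<bar>) / 2 \<and> (a \<bullet> x + \<bar>b \<bullet> x + real j / 8\<bar>) / 2 \<le> 1"
      by simp
    then show "0 \<le> h j" "h j \<le> 1" unfolding h by blast+
  qed
  have err: "(N j)\<^sup>2 - (h j)\<^sup>2 \<le> 3 / 2000" "(h j)\<^sup>2 - (N j)\<^sup>2 \<le> 3 / 2000" if "j < 4" for j
    using square_diff_le[OF close[OF that] h01[OF that]] unfolding abs_le_iff by simp_all
  have "(N 3)\<^sup>2 - 3 * (N 2)\<^sup>2 + 3 * (N 1)\<^sup>2 - (N 0)\<^sup>2 = 0"
    using directional_moment_third_difference[OF m, of x "(1 / 8) *\<^sub>R b"] by (simp add: N_def p_def)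
  moreover have "(h 3)\<^sup>2 - 3 * (h 2)\<^sup>2 + 3 * (h 1)\<^sup>2 - (h 0)\<^sup>2 \<le> - 7 / 512"
    using l1_square_third_difference_le[of "a \<bullet> x" "b \<bullet> x"] z \<alpha> \<beta> by (simp add: h)
  ultimately show False
    using err(2)[of 0] err(1)[of 1] err(2)[of 2] err(1)[of 3] by simp
qed

section \<open>From the pointwise gap to a gap on the sphere\<close>

lemma nn_integral_lborel_translate:
  fixes f :: "'a::euclidean_space \<Rightarrow> ennreal"
  assumes [measurable]: "f \<in> borel_measurable borel"
  shows "(\<integral>\<^sup>+x. f (x + c) \<partial>lborel) = (\<integral>\<^sup>+x. f x \<partial>lborel)"
proof -
  have "(\<integral>\<^sup>+x. f x \<partial>lborel) = (\<integral>\<^sup>+x. f x \<partial>distr lborel borel ((+) c))"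
    by (simp add: lborel_distr_plus)
  also have "\<dots> = (\<integral>\<^sup>+x. f (x + c) \<partial>lborel)"
    by (subst nn_integral_distr) (auto simp: add.commute)
  finally show ?thesis by simp
qed

text \<open>Homogeneity gives \<open>f x \<le> f (sgn x)\<close> on the unit ball, and
  \<open>sphere_uniform\<close> is the law of \<open>sgn x\<close>. This comparison takes the place
  of polar coordinates.\<close>

lemma nn_integral_ball_le_sphere_uniform:
  fixes f :: "'a::euclidean_space \<Rightarrow> real"
  assumes [measurable]: "f \<in> borel_measurable borel" and nonneg: "\<And>x. 0 \<le> f x"
    and hom: "\<And>c x. f (c *\<^sub>R x) = c\<^sup>2 * f x"
  shows "(\<integral>\<^sup>+x. ennreal (f x) * indicator (ball 0 1) x \<partial>lborel)
    \<le> emeasure lborel (ball (0::'a) 1) * (\<integral>\<^sup>+\<theta>. ennreal (f \<theta>) \<partial>sphere_uniform)"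
proof -
  let ?V = "emeasure lborel (ball (0::'a) 1)"
  have V: "?V \<noteq> 0" "?V \<noteq> \<infinity>"
    using content_ball_pos[of 1 "0::'a"] emeasure_lborel_ball_finite[of "0::'a" 1]
    by (auto simp: measure_def)
  have le: "f x \<le> f (sgn x)" if "x \<in> ball 0 1" for x
  proof -
    have "f x = (norm x)\<^sup>2 * f (sgn x)"
      using hom[of "norm x" "sgn x"] by (cases "x = 0") (auto simp: sgn_div_norm hom[of 0, simplified])
    also have "\<dots> \<le> 1 * f (sgn x)"
      using that nonneg by (intro mult_right_mono) (auto simp: power_le_one)
    finally show ?thesis by simp
  qed
  have "(\<integral>\<^sup>+\<theta>. ennreal (f \<theta>) \<partial>sphere_uniform) = (\<integral>\<^sup>+x. ennreal (f (sgn x)) \<partial>uniform_measure lborel (ball (0::'a) 1))"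
    unfolding sphere_uniform_def by (subst nn_integral_distr) auto
  also have "\<dots> = (\<integral>\<^sup>+x. ennreal (f (sgn x)) * indicator (ball 0 1) x \<partial>lborel) / ?V"
    by (subst nn_integral_uniform_measure) auto
  finally have "?V * (\<integral>\<^sup>+\<theta>. ennreal (f \<theta>) \<partial>sphere_uniform) = (\<integral>\<^sup>+x. ennreal (f (sgn x)) * indicator (ball 0 1) x \<partial>lborel)"
    using V by (simp add: ennreal_times_divide mult.commute[of ?V] ennreal_mult_divide_eq)
  moreover have "(\<integral>\<^sup>+x. ennreal (f x) * indicator (ball 0 1) x \<partial>lborel) \<le> \<dots>"
    by (intro nn_integral_mono) (auto simp: indicator_def intro!: ennreal_leI le)
  ultimately show ?thesis by simp
qed

text \<open>The pointwise gap is integrated over a small ball of base points. Its four translates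
  lie in the unit ball, and the homogeneous integrand is then carried to the sphere. The resulting
  constant is the same for all \<open>m\<close>.\<close>

lemma directional_moment_not_l1:
  fixes a b :: "'a::euclidean_space"
  assumes ab: "a \<in> Basis" "b \<in> Basis" "a \<noteq> b"
  obtains \<eta> :: real where "0 < \<eta>"
    "\<And>m. m \<in> P2 \<Longrightarrow> integrable sphere_uniform (\<lambda>x. (directional_moment m x - (\<bar>a \<bullet> x\<bar> + \<bar>b \<bullet> x\<bar>) / 2)\<^sup>2) \<Longrightarrow>
      \<eta> \<le> (\<integral>x. (directional_moment m x - (\<bar>a \<bullet> x\<bar> + \<bar>b \<bullet> x\<bar>) / 2)\<^sup>2 \<partial>sphere_uniform)"
proof
  let ?x0 = "(1 / 4) *\<^sub>R a - (1 / 8) *\<^sub>R b"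
  let ?V = "measure lborel (ball (0::'a) 1)" and ?v = "measure lborel (ball ?x0 (1 / 32))"
  have V: "0 < ?V" and v: "0 < ?v" by (auto intro: content_ball_pos)
  have eV: "emeasure lborel (ball (0::'a) 1) = ennreal ?V" and ev: "emeasure lborel (ball ?x0 (1 / 32)) = ennreal ?v"
    using emeasure_lborel_ball_finite[of "0::'a" 1] emeasure_lborel_ball_finite[of ?x0 "1 / 32"]
    by (auto simp: emeasure_eq_ennreal_measure)
  \<comment> \<open>The gap contributes \<open>(1 / 2000)\<^sup>2 * ?v\<close> on the small ball;
    the factor 4 counts the translates and \<open>?V\<close> comes from the passage to the
    sphere.\<close>
  show "0 < (1 / 2000)\<^sup>2 * ?v / (4 * ?V)" using v V by simp
  fix m :: "'a measure" assume m: "m \<in> P2"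
  define f where "f x = (directional_moment m x - (\<bar>a \<bullet> x\<bar> + \<bar>b \<bullet> x\<bar>) / 2)\<^sup>2" for x
  have [measurable]: "f \<in> borel_measurable borel"
    unfolding f_def[abs_def] using directional_moment_measurable[OF m] by measurable
  have f0: "0 \<le> f x" for x by (simp add: f_def)
  have hom: "f (c *\<^sub>R x) = c\<^sup>2 * f x" for c x
  proof -
    have "f (c *\<^sub>R x) = (\<bar>c\<bar> * (directional_moment m x - (\<bar>a \<bullet> x\<bar> + \<bar>b \<bullet> x\<bar>) / 2))\<^sup>2"
      unfolding f_def directional_moment_scaleR by (simp add: abs_mult algebra_simps)
    then show ?thesis by (simp add: power_mult_distrib f_def)
  qed
  assume "integrable sphere_uniform (\<lambda>x. (directional_moment m x - (\<bar>a \<bullet> x\<bar> + \<bar>b \<bullet> x\<bar>) / 2)\<^sup>2)"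
  then have i: "integrable sphere_uniform f" by (simp add: f_def[abs_def])
  define F where "F x = ennreal (f x) * indicator (ball 0 1) x" for x
  have [measurable]: "ball (0::'a) 1 \<in> sets borel" by simp
  have [measurable]: "F \<in> borel_measurable borel" unfolding F_def[abs_def] by measurable
  \<comment> \<open>The bound is 1/32 + 1/4 + 3/8 = 21/32, below 1.\<close>
  have in_ball: "x + (real j / 8) *\<^sub>R b \<in> ball 0 1" if "x \<in> ball ?x0 (1 / 32)" "j < 4" for x j
  proof -
    have "x + (real j / 8) *\<^sub>R b = (x - ?x0) + ((1 / 4) *\<^sub>R a + ((real j - 1) / 8) *\<^sub>R b)"
      by (simp add: scaleR_left_diff_distrib diff_divide_distrib)
    also have "norm \<dots> \<le> norm (x - ?x0) + (norm ((1 / 4) *\<^sub>R a) + norm (((real j - 1) / 8) *\<^sub>R b))"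
      by (intro norm_triangle_le add_mono norm_triangle_ineq order.refl)
    also have "\<dots> < 1 / 32 + (1 / 4 + 3 / 8)"
      using that ab by (intro add_less_le_mono add_mono) (auto simp: dist_norm norm_minus_commute)
    finally show ?thesis by simp
  qed
  have "ennreal ((1 / 2000)\<^sup>2 * ?v) = (\<integral>\<^sup>+x. ennreal ((1 / 2000)\<^sup>2) * indicator (ball ?x0 (1 / 32)) x \<partial>lborel)"
    by (subst nn_integral_cmult_indicator) (auto simp: ev intro: ennreal_mult')
  also have "\<dots> \<le> (\<integral>\<^sup>+x. (\<Sum>j<4. F (x + (real j / 8) *\<^sub>R b)) \<partial>lborel)"
  proof (rule nn_integral_mono)
    fix x :: 'a
    show "ennreal ((1 / 2000)\<^sup>2) * indicator (ball ?x0 (1 / 32)) x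
      \<le> (\<Sum>j<4. F (x + (real j / 8) *\<^sub>R b))"
    proof (cases "x \<in> ball ?x0 (1 / 32)")
      case True
      have "ennreal ((1 / 2000)\<^sup>2) \<le> ennreal (\<Sum>j<4. f (x + (real j / 8) *\<^sub>R b))"
        using directional_moment_not_l1_pointwise[OF m ab True] by (intro ennreal_leI) (simp only: f_def)
      also have "\<dots> = (\<Sum>j<4. ennreal (f (x + (real j / 8) *\<^sub>R b)))"
        by (rule sum_ennreal[symmetric]) (rule f0)
      also have "\<dots> = (\<Sum>j<4. F (x + (real j / 8) *\<^sub>R b))"
        by (intro sum.cong refl) (simp only: F_def indicator_simps(1)[OF in_ball[OF True]] lessThan_iff mult_1_right)
      finally show ?thesis using True by simp
    qed simp
  qed
  also have "\<dots> = (\<Sum>j<(4::nat). \<integral>\<^sup>+x. F (x + (real j / 8) *\<^sub>R b) \<partial>lborel)"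
    by (subst nn_integral_sum) auto
  also have "\<dots> = (\<Sum>j<(4::nat). \<integral>\<^sup>+x. F x \<partial>lborel)"
    by (intro sum.cong refl nn_integral_lborel_translate) simp
  also have "\<dots> = 4 * (\<integral>\<^sup>+x. F x \<partial>lborel)"
    by simp
  also have "\<dots> \<le> 4 * (ennreal ?V * (\<integral>\<^sup>+\<theta>. ennreal (f \<theta>) \<partial>sphere_uniform))"
    using nn_integral_ball_le_sphere_uniform[of f] f0 hom unfolding eV F_def by (intro mult_left_mono) auto
  also have "\<dots> = ennreal (4 * ?V * (\<integral>\<theta>. f \<theta> \<partial>sphere_uniform))"
    using f0 by (subst nn_integral_eq_integral[OF i]) (auto simp: ennreal_mult' mult.assoc)
  finally have "(1 / 2000)\<^sup>2 * ?v \<le> 4 * ?V * (\<integral>\<theta>. f \<theta> \<partial>sphere_uniform)"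
    using f0 by (subst (asm) ennreal_le_iff) auto
  then show "(1 / 2000)\<^sup>2 * ?v / (4 * ?V) \<le> (\<integral>x. (directional_moment m x - (\<bar>a \<bullet> x\<bar> + \<bar>b \<bullet> x\<bar>) / 2)\<^sup>2 \<partial>sphere_uniform)"
    using V by (simp add: f_def[abs_def] field_simps)
qed

text \<open>The parallelogram identity is integrated over the sphere, and the distances of the
  moments to that of \<open>m\<close> are bounded by \<open>SW\<close>.\<close>

lemma directional_moment_midpoint:
  fixes \<mu> \<nu> m :: "'a::euclidean_space measure"
  assumes P2: "\<mu> \<in> P2" "\<nu> \<in> P2" "m \<in> P2"
  shows "integrable sphere_uniform (\<lambda>x. (directional_moment m x - (directional_moment \<mu> x + directional_moment \<nu> x) / 2)\<^sup>2)"
    and "(\<integral>x. (directional_moment m x - (directional_moment \<mu> x + directional_moment \<nu> x) / 2)\<^sup>2 \<partial>sphere_uniform)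
      \<le> (SW \<mu> m)\<^sup>2 / 2 + (SW m \<nu>)\<^sup>2 / 2
        - (\<integral>x. (directional_moment \<mu> x - directional_moment \<nu> x)\<^sup>2 \<partial>sphere_uniform) / 4"
proof -
  have meas [measurable]: "directional_moment \<mu> \<in> borel_measurable borel"
    "directional_moment \<nu> \<in> borel_measurable borel" "directional_moment m \<in> borel_measurable borel"
    using P2 directional_moment_measurable by auto
  let ?d = "\<lambda>\<mu> \<nu> x. (directional_moment \<mu> x - directional_moment \<nu> x)\<^sup>2"
  have i: "integrable sphere_uniform (?d \<mu> m)" "integrable sphere_uniform (?d m \<nu>)" "integrable sphere_uniform (?d \<mu> \<nu>)"
    by (auto intro!: L2_diff_integrable directional_moment_square_integrable P2)
  have par: "(directional_moment m x - (directional_moment \<mu> x + directional_moment \<nu> x) / 2)\<^sup>2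
    = ?d \<mu> m x / 2 + ?d m \<nu> x / 2 - ?d \<mu> \<nu> x / 4" for x
    by (simp add: power2_eq_square field_simps)
  show "integrable sphere_uniform (\<lambda>x. (directional_moment m x - (directional_moment \<mu> x + directional_moment \<nu> x) / 2)\<^sup>2)"
    unfolding par using i by simp
  show "(\<integral>x. (directional_moment m x - (directional_moment \<mu> x + directional_moment \<nu> x) / 2)\<^sup>2 \<partial>sphere_uniform)
      \<le> (SW \<mu> m)\<^sup>2 / 2 + (SW m \<nu>)\<^sup>2 / 2 - (\<integral>x. ?d \<mu> \<nu> x \<partial>sphere_uniform) / 4"
    unfolding par using i directional_moment_diff_le_SW[OF P2(1,3)] directional_moment_diff_le_SW[OF P2(3,2)]
    by simp
qed

section \<open>Contradiction from an almost shortest curve between two symmetric pairs\<close>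

theorem corollary4p8:
  assumes "DIM('a::euclidean_space) \<ge> 2"
  shows "\<not> length_space (P2 :: 'a measure set) SW"
proof
  assume length: "length_space (P2 :: 'a measure set) SW"
  obtain a :: 'a where a: "a \<in> Basis" using nonempty_Basis by blast
  have "(Basis :: 'a set) \<noteq> {a}"
  proof
    assume "(Basis :: 'a set) = {a}"
    then have "DIM('a) = card {a}" by (rule arg_cong)
    then show False using assms by simp
  qed
  with a obtain b :: 'a where b: "b \<in> Basis" "a \<noteq> b" by blast
  obtain \<eta> :: real where \<eta>: "0 < \<eta>" and gap:
    "\<And>m. m \<in> P2 \<Longrightarrow> integrable sphere_uniform (\<lambda>x. (directional_moment m x - (\<bar>a \<bullet> x\<bar> + \<bar>b \<bullet> x\<bar>) / 2)\<^sup>2) \<Longrightarrow>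
      \<eta> \<le> (\<integral>x. (directional_moment m x - (\<bar>a \<bullet> x\<bar> + \<bar>b \<bullet> x\<bar>) / 2)\<^sup>2 \<partial>sphere_uniform)"
    using directional_moment_not_l1[OF a b] by blast
  let ?\<mu> = "symmetric_pair a" and ?\<nu> = "symmetric_pair b"
  note P2 = symmetric_pair_P2[of a] symmetric_pair_P2[of b]
  define D where "D = SW ?\<mu> ?\<nu>"
  have D0: "0 \<le> D" by (simp add: D_def SW_nonneg)
  \<comment> \<open>The final bound is \<open>\<epsilon> * (D + \<epsilon>) / 2\<close>. Using
    \<open>\<epsilon> \<le> 1\<close> and \<open>\<epsilon> * (D + 1) \<le> \<eta>\<close>, it is at
    most \<open>\<eta> / 2\<close>.\<close>
  define \<epsilon> where "\<epsilon> = min 1 (\<eta> / (D + 1))"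
  have \<epsilon>: "0 < \<epsilon>" "\<epsilon> \<le> 1" "\<epsilon> \<le> \<eta> / (D + 1)"
    using \<eta> D0 by (simp_all add: \<epsilon>_def)
  then have \<epsilon>D: "\<epsilon> * (D + 1) \<le> \<eta>" using D0 by (simp add: pos_le_divide_eq)
  have "length_metric P2 SW ?\<mu> ?\<nu> = ennreal D"
    using length P2 unfolding length_space_def D_def by simp
  also have "\<dots> < ennreal (D + \<epsilon>)" using \<epsilon> D0 by (simp add: ennreal_less_iff)
  finally obtain c where c: "abs_cont_curve P2 SW c" and ends: "c 0 = ?\<mu>" "c 1 = ?\<nu>"
    and short: "(\<integral>\<^sup>+ t\<in>{0..1}. ennreal (metric_deriv SW c t) \<partial>lborel) < ennreal (D + \<epsilon>)"
    unfolding length_metric_def INF_less_iff by blast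
  obtain \<tau> where \<tau>: "0 \<le> \<tau>" "\<tau> \<le> 1" and half: "SW (c 0) (c \<tau>) = SW (c 0) (c 1) / 2"
    by (rule abs_cont_curve_midpoint[OF c]) (use SW_commute SW_triangle SW_nonneg SW_self in auto)
  have m: "c \<tau> \<in> P2" using c \<tau> by (simp add: abs_cont_curve_def)
  have "ennreal (SW (c 0) (c \<tau>) + SW (c \<tau>) (c 1)) \<le> (\<integral>\<^sup>+ t\<in>{0..1}. ennreal (metric_deriv SW c t) \<partial>lborel)"
    by (rule abs_cont_curve_length_ge[OF c]) (use SW_commute SW_triangle \<tau> in auto)
  then have "ennreal (SW (c 0) (c \<tau>) + SW (c \<tau>) (c 1)) < ennreal (D + \<epsilon>)"
    using short by (rule le_less_trans)
  then have "SW (c 0) (c \<tau>) + SW (c \<tau>) (c 1) < D + \<epsilon>"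
    by (subst (asm) ennreal_less_iff) (auto simp: SW_nonneg)
  then have near: "SW (c \<tau>) ?\<nu> \<le> D / 2 + \<epsilon>"
    using half by (simp add: ends D_def)
  have half': "SW ?\<mu> (c \<tau>) = D / 2" using half by (simp add: ends D_def)
  \<comment> \<open>Since the moments of the two pairs are at \<open>L\<^sup>2\<close> distance at
    least \<open>D\<close>, the subtracted term is at least \<open>D\<^sup>2 / 4\<close>.\<close>
  have "(\<integral>x. (directional_moment (c \<tau>) x - (\<bar>a \<bullet> x\<bar> + \<bar>b \<bullet> x\<bar>) / 2)\<^sup>2 \<partial>sphere_uniform)
    \<le> (D / 2)\<^sup>2 / 2 + (SW (c \<tau>) ?\<nu>)\<^sup>2 / 2 - D\<^sup>2 / 4"
    using directional_moment_midpoint(2)[OF P2 m] SW_symmetric_pair_le[of a b]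
    unfolding half' D_def[symmetric] directional_moment_symmetric_pair by linarith
  also have "\<dots> \<le> (D / 2)\<^sup>2 / 2 + (D / 2 + \<epsilon>)\<^sup>2 / 2 - D\<^sup>2 / 4"
    using power_mono[OF near SW_nonneg, of 2] by simp
  also have "\<dots> = \<epsilon> * (D + \<epsilon>) / 2" by (simp add: power2_eq_square field_simps)
  also have "\<dots> \<le> \<epsilon> * (D + 1) / 2" using \<epsilon> by (intro divide_right_mono mult_left_mono) auto
  also have "\<dots> < \<eta>" using \<epsilon>D \<eta> by simp
  finally show False
    using gap[OF m] directional_moment_midpoint(1)[OF P2 m] by (simp add: directional_moment_symmetric_pair)
qed

end
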